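(* Let $n,p,k,m\in\mathbb N$, let $R=[r_1\dots r_k]^T$ with $r_i\in\mathbb N$, $\Lambda=[\lambda_1\dots\lambda_m]^T$ with $\lambda_i\in\mathbb N$, and $H=[h_1\dots h_m]^T$ with $h_1,\dots,h_m\in\{2,\dots,n\}$ distinct; let $J_k=[1\dots1]^T$ ($k$ entries). Then $\Lambda K^H_{n\times p}$ is almost $R$-factorizable if and only if $\sum_{i=1}^k r_i-k\le\sum_{i=1}^m\lambda_i\binom{n-1}{h_i-1}p^{h_i-1}\le\sum_{i=1}^k r_i$ and there exists a non-negative integer matrix $A=[a_{ij}]_{k\times m}$ such that $np(R-J_k)\le AH\le npR$ componentwise and $\sum_{i=1}^k a_{ij}=\lambda_j\binom{n}{h_j}p^{h_j}$ for $1\le j\le m$.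
   Context: $\Lambda K^H_{n\times p}$ is the hypergraph with vertex set partitioned into $n$ parts each of size $p$, in which, for each $1\le i\le m$ and each set of $h_i$ vertices containing at most one vertex from each part, there are exactly $\lambda_i$ edges of size $h_i$ joining exactly those vertices (one hinge per vertex); there are no other edges. A $(q,r)$-factor is a spanning sub-hypergraph in which every vertex $v$ has $q\le d(v)\le r$. An almost $R$-factorization is a partition $\{F_1,\dots,F_k\}$ of the edge set such that $F_i$ is an $(r_i-1,r_i)$-factor for $1\le i\le k$. *)

theory Defs
  imports Complex_Main "HOL-Library.Multiset" "HOL-Library.Disjoint_Sets"
begin

text \<open>
  Hypergraphs with parallel edges and hinges. The hinges of an edge are recorded as a multiset
  of vertices: \<open>count (ends G e) v\<close> is the number of hinges joining the edge \<open>e\<close> to the vertex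
  \<open>v\<close>, and \<open>size (ends G e)\<close> is the size of \<open>e\<close>. Distinct edges may have the same ends.
\<close>

record ('v, 'e) hypergraph =
  verts :: "'v set"
  edges :: "'e set"
  ends :: "'e \<Rightarrow> 'v multiset"

definition wf_hypergraph :: "('v, 'e) hypergraph \<Rightarrow> bool" where
  "wf_hypergraph G \<longleftrightarrow> finite (verts G) \<and> finite (edges G) \<and>
     (\<forall>e\<in>edges G. ends G e \<noteq> {#} \<and> set_mset (ends G e) \<subseteq> verts G)"

definition degree :: "('v, 'e) hypergraph \<Rightarrow> 'v \<Rightarrow> nat" where
  "degree G v = (\<Sum>e\<in>edges G. count (ends G e) v)"

definition spanning_subhypergraph :: "('v, 'e) hypergraph \<Rightarrow> ('v, 'e) hypergraph \<Rightarrow> bool" where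
  "spanning_subhypergraph F G \<longleftrightarrow>
     wf_hypergraph F \<and> wf_hypergraph G \<and> verts F = verts G \<and> edges F \<subseteq> edges G \<and>
     (\<forall>e\<in>edges F. ends F e = ends G e)"

text \<open>The bounds are integers, so that an \<open>(r - 1, r)\<close>-factor makes sense also for \<open>r = 0\<close>.\<close>

definition is_factor :: "int \<Rightarrow> int \<Rightarrow> ('v, 'e) hypergraph \<Rightarrow> ('v, 'e) hypergraph \<Rightarrow> bool" where
  "is_factor q r F G \<longleftrightarrow> spanning_subhypergraph F G \<and>
     (\<forall>v\<in>verts F. q \<le> int (degree F v) \<and> int (degree F v) \<le> r)"

text \<open>
  The classes of the partition are indexed by \<open>1, \<dots>, k\<close> and may be empty, since an
  \<open>(r - 1, r)\<close>-factor with \<open>r = 1\<close> need not have any edges.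
\<close>

definition almost_factorization ::
  "nat \<Rightarrow> (nat \<Rightarrow> nat) \<Rightarrow> (nat \<Rightarrow> ('v, 'e) hypergraph) \<Rightarrow> ('v, 'e) hypergraph \<Rightarrow> bool" where
  "almost_factorization k r F G \<longleftrightarrow>
     (\<Union>i\<in>{1..k}. edges (F i)) = edges G \<and>
     disjoint_family_on (\<lambda>i. edges (F i)) {1..k} \<and>
     (\<forall>i\<in>{1..k}. is_factor (int (r i) - 1) (int (r i)) (F i) G)"

definition almost_factorizable :: "nat \<Rightarrow> (nat \<Rightarrow> nat) \<Rightarrow> ('v, 'e) hypergraph \<Rightarrow> bool" where
  "almost_factorizable k r G \<longleftrightarrow> (\<exists>F. almost_factorization k r F G)"

text \<open>
  The vertex \<open>(a, b)\<close> is the \<open>b\<close>-th vertex of the \<open>a\<close>-th part. A set of vertices contains at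
  most one vertex of each part iff \<open>fst\<close> is injective on it.
\<close>

definition transversals :: "nat \<Rightarrow> nat \<Rightarrow> nat \<Rightarrow> (nat \<times> nat) set set" where
  "transversals n p s = {S. S \<subseteq> {1..n} \<times> {1..p} \<and> inj_on fst S \<and> card S = s}"

text \<open>The edges \<open>(i, S, c)\<close> with \<open>1 \<le> c \<le> lam i\<close> are the \<open>lam i\<close> parallel edges on \<open>S\<close>.\<close>

definition LamK ::
  "nat \<Rightarrow> nat \<Rightarrow> nat \<Rightarrow> (nat \<Rightarrow> nat) \<Rightarrow> (nat \<Rightarrow> nat) \<Rightarrow>
   (nat \<times> nat, nat \<times> (nat \<times> nat) set \<times> nat) hypergraph" where
  "LamK n p m lam h =
     \<lparr>verts = {1..n} \<times> {1..p},
      edges = (SIGMA i:{1..m}. transversals n p (h i) \<times> {1..lam i}),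
      ends = (\<lambda>(i, S, c). mset_set S)\<rparr>"

lemma finite_transversals: "finite (transversals n p s)"
  by (rule finite_subset[of _ "Pow ({1..n} \<times> {1..p})"]) (auto simp: transversals_def)

lemma wf_LamK:
  assumes "\<forall>i\<in>{1..m}. h i \<in> {2..n}"
  shows "wf_hypergraph (LamK n p m lam h)"
proof -
  have *: "finite S \<and> S \<noteq> {} \<and> S \<subseteq> {1..n} \<times> {1..p}"
    if i: "i \<in> {1..m}" and S: "S \<in> transversals n p (h i)" for i S
  proof -
    have "h i \<ge> 2" using assms i by auto
    then have "card S > 0" using S by (auto simp: transversals_def)
    then show ?thesis using S by (auto simp: transversals_def card_gt_0_iff)
  qed
  have "finite (edges (LamK n p m lam h))"
    by (auto simp: LamK_def intro!: finite_SigmaI finite_transversals)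
  moreover have "ends (LamK n p m lam h) e \<noteq> {#} \<and>
      set_mset (ends (LamK n p m lam h) e) \<subseteq> verts (LamK n p m lam h)"
    if "e \<in> edges (LamK n p m lam h)" for e
  proof -
    from that obtain i S c where e: "e = (i, S, c)" "i \<in> {1..m}" "S \<in> transversals n p (h i)"
      by (auto simp: LamK_def)
    with *[OF e(2,3)] show ?thesis by (simp add: LamK_def mset_set_empty_iff)
  qed
  ultimately show ?thesis by (simp add: wf_hypergraph_def LamK_def)
qed

lemma edges_of_LamK:
  assumes "e \<in> edges (LamK n p m lam h)"
  shows "\<exists>i\<in>{1..m}. \<exists>S\<in>transversals n p (h i). ends (LamK n p m lam h) e = mset_set S"
  using assms by (auto simp: LamK_def)

lemma multiplicity_LamK:
  assumes h: "\<forall>i\<in>{1..m}. h i \<in> {2..n}" "inj_on h {1..m}"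
    and i: "i \<in> {1..m}" and S: "S \<in> transversals n p (h i)"
  shows "card {e \<in> edges (LamK n p m lam h). ends (LamK n p m lam h) e = mset_set S} = lam i"
proof -
  have fin: "finite T" if "T \<in> transversals n p s" for T s
    using that by (auto simp: transversals_def intro: finite_subset)
  have "{e \<in> edges (LamK n p m lam h). ends (LamK n p m lam h) e = mset_set S}
      = (\<lambda>c. (i, S, c)) ` {1..lam i}"
  proof (intro set_eqI iffI)
    fix e assume "e \<in> {e \<in> edges (LamK n p m lam h). ends (LamK n p m lam h) e = mset_set S}"
    then obtain j T c where e: "e = (j, T, c)" "j \<in> {1..m}" "T \<in> transversals n p (h j)"
        "c \<in> {1..lam j}" "mset_set T = mset_set S"
      by (auto simp: LamK_def)
    have "T = S" using e(5) fin[OF e(3)] fin[OF S] by (metis finite_set_mset_mset_set)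
    with e(3) S have "h j = h i" by (auto simp: transversals_def)
    with h(2) e(2) i have "j = i" by (auto dest: inj_onD)
    with e \<open>T = S\<close> show "e \<in> (\<lambda>c. (i, S, c)) ` {1..lam i}" by auto
  next
    fix e assume "e \<in> (\<lambda>c. (i, S, c)) ` {1..lam i}"
    with i S show "e \<in> {e \<in> edges (LamK n p m lam h). ends (LamK n p m lam h) e = mset_set S}"
      by (auto simp: LamK_def)
  qed
  then show ?thesis by (simp add: card_image inj_on_def)
qed

end

theory Submission
  imports Defs
begin

text \<open>
  Sufficiency is an amalgamation--detachment argument. Start from a single vertex carrying all hinges,
  where \<open>A\<close> is the colouring, and detach the \<open>n\<close> parts one after the other. If \<open>q\<close> parts are left, a
  fraction \<open>1 / q\<close> of the remaining hinges has to go to the next part, for every colour and for every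
  class of edges with the same size and the same vertices so far. Viewed as a matrix with colours as
  rows and edge classes as columns, these fractional amounts have integral column sums, and they can
  be rounded to integers so that column sums stay exact and row sums move to a neighbouring
  integer. The hinges of the new part are then distributed among its \<open>p\<close> vertices by rounding again,
  with fractions \<open>1 / p\<close>. Necessity is double counting.
\<close>

subsection \<open>Rounding of matrices\<close>

lemma underdetermined_system:
  fixes a :: "'v \<Rightarrow> 'e \<Rightarrow> real"
  assumes "finite V" "finite E" "card V < card E"
  shows "\<exists>x. (\<exists>e\<in>E. x e \<noteq> 0) \<and> (\<forall>v\<in>V. (\<Sum>e\<in>E. a v e * x e) = 0)"
  using assms
proof (induction V arbitrary: E a rule: finite_induct)
  case empty
  then have "E \<noteq> {}" by auto
  then show ?case by (intro exI[of _ "\<lambda>_. 1"]) auto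
next
  case (insert v V)
  show ?case
  proof (cases "\<forall>e\<in>E. a v e = 0")
    case True
    have "card V < card E" using insert by simp
    from insert.IH[OF insert.prems(1) this, of a] obtain x where
      x: "\<exists>e\<in>E. x e \<noteq> 0" "\<forall>w\<in>V. (\<Sum>e\<in>E. a w e * x e) = 0" by blast
    moreover have "(\<Sum>e\<in>E. a v e * x e) = 0" using True by (intro sum.neutral) simp
    ultimately show ?thesis by (intro exI[of _ x]) simp
  next
    case False
    then obtain d where d: "d \<in> E" "a v d \<noteq> 0" by blast
    define E' where "E' = E - {d}"
    have E': "finite E'" "d \<notin> E'" "E = insert d E'" "card V < card E'"
      using insert d by (auto simp: E'_def)
    \<comment> \<open>Equation \<open>v\<close> is solved for the unknown \<open>d\<close> and
      substituted into the other equations, which produces these coefficients.\<close>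
    obtain x where x: "\<exists>e\<in>E'. x e \<noteq> 0"
      "\<And>w. w \<in> V \<Longrightarrow> (\<Sum>e\<in>E'. (a w e - a w d * a v e / a v d) * x e) = 0"
      using insert.IH[OF E'(1,4), of "\<lambda>w e. a w e - a w d * a v e / a v d"] by blast
    define s where "s = (\<Sum>e\<in>E'. a v e * x e)"
    \<comment> \<open>The value at \<open>d\<close> is forced by equation \<open>v\<close>.\<close>
    define x' where "x' = x(d := - s / a v d)"
    have *: "(\<Sum>e\<in>E. a w e * x' e) = (\<Sum>e\<in>E'. a w e * x e) - a w d * s / a v d" for w
    proof -
      have "(\<Sum>e\<in>E'. a w e * x' e) = (\<Sum>e\<in>E'. a w e * x e)"
        using E'(2) by (intro sum.cong) (auto simp: x'_def)
      then show ?thesis using E' by (simp add: x'_def)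
    qed
    have "(\<Sum>e\<in>E. a w e * x' e) = 0" if "w \<in> insert v V" for w
    proof (cases "w = v")
      case True
      then show ?thesis using d by (simp add: * s_def)
    next
      case False
      then have "w \<in> V" using that by simp
      have "0 = (\<Sum>e\<in>E'. a w e * x e - a w d / a v d * (a v e * x e))"
        using x(2)[OF \<open>w \<in> V\<close>] by (simp add: algebra_simps)
      also have "\<dots> = (\<Sum>e\<in>E. a w e * x' e)"
        by (simp add: * s_def sum_subtractf sum_distrib_left sum_divide_distrib)
      finally show ?thesis by simp
    qed
    moreover have "\<exists>e\<in>E. x' e \<noteq> 0" using x(1) E' by (auto simp: x'_def)
    ultimately show ?thesis by blast
  qed
qed

text \<open>Each nonempty fibre of \<open>f\<close> on \<open>F\<close> has at least two elements,
  and the fibres partition \<open>F\<close>. For \<open>fst\<close> and \<open>snd\<close> this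
  bounds the number of rows and columns met by fractional cells.\<close>

lemma twice_card_image_le:
  assumes "finite F" and "\<And>e. e \<in> F \<Longrightarrow> \<exists>e'\<in>F. e' \<noteq> e \<and> f e' = f e"
  shows "2 * card (f ` F) \<le> card F"
proof -
  have "2 \<le> card {e \<in> F. f e = y}" if y: "y \<in> f ` F" for y
  proof -
    obtain e where e: "e \<in> F" "f e = y" using y by blast
    with assms(2) obtain e' where "e' \<in> F" "e' \<noteq> e" "f e' = y" by metis
    with e have "card {e, e'} \<le> card {e \<in> F. f e = y}"
      using assms(1) by (intro card_mono) auto
    with \<open>e' \<noteq> e\<close> show ?thesis by simp
  qed
  then have "2 * card (f ` F) \<le> (\<Sum>y\<in>f ` F. card {e \<in> F. f e = y})"
    using sum_mono[of "f ` F" "\<lambda>_. 2" "\<lambda>y. card {e \<in> F. f e = y}"] by simp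
  also have "\<dots> = card F"
    using sum.image_gen[OF assms(1), of "\<lambda>_. 1 :: nat" f] by simp
  finally show ?thesis .
qed

text \<open>Otherwise \<open>z a\<close> would be a difference of two integers. Hence no row or
  column with an integral sum has exactly one fractional entry.\<close>

lemma another_non_integer:
  fixes z :: "'a \<Rightarrow> real"
  assumes "finite A" "sum z A \<in> \<int>" "a \<in> A" "z a \<notin> \<int>"
  shows "\<exists>b\<in>A. b \<noteq> a \<and> z b \<notin> \<int>"
proof (rule ccontr)
  assume "\<not> ?thesis"
  then have "sum z (A - {a}) \<in> \<int>" by (auto intro: Ints_sum)
  moreover have "z a = sum z A - sum z (A - {a})"
    using assms by (simp add: sum.remove)
  ultimately show False using assms by (metis Ints_diff)
qed

text \<open>The cells of \<open>F\<close> are the unknowns; the rows and columns they meet give the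
  equations. The cardinality hypotheses allow at most \<open>card F\<close> equations, and one of
  them is redundant because row sums and column sums have the same total.\<close>

lemma zero_margins_perturbation:
  fixes F :: "('a \<times> 'b) set"
  assumes F: "finite F" "F \<noteq> {}"
    and "2 * card (fst ` F) \<le> card F" "2 * card (snd ` F) \<le> card F"
  shows "\<exists>x :: 'a \<times> 'b \<Rightarrow> real. (\<exists>e\<in>F. x e \<noteq> 0) \<and>
    (\<forall>i. (\<Sum>e\<in>F. if fst e = i then x e else 0) = 0) \<and>
    (\<forall>c. (\<Sum>e\<in>F. if snd e = c then x e else 0) = 0)"
proof -
  obtain i0 where i0: "i0 \<in> fst ` F" using F by auto
  \<comment> \<open>The equation of row \<open>i0\<close> is left out; it is recovered at the end
    from the vanishing of the total.\<close>
  define V where "V = Inl ` (fst ` F - {i0}) \<union> Inr ` (snd ` F)"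
  have "card V = card (fst ` F - {i0}) + card (snd ` F)"
    unfolding V_def using F(1) by (subst card_Un_disjoint) (auto simp: card_image)
  moreover have "card (fst ` F) > 0" using i0 F(1) by (auto simp: card_gt_0_iff)
  ultimately have V: "finite V" "card V < card F"
    using assms i0 by (auto simp: V_def)
  let ?a = "\<lambda>v e. case v of Inl i \<Rightarrow> of_bool (fst e = i) | Inr c \<Rightarrow> (of_bool (snd e = c) :: real)"
  obtain x where x: "\<exists>e\<in>F. x e \<noteq> 0" "\<And>v. v \<in> V \<Longrightarrow> (\<Sum>e\<in>F. ?a v e * x e) = 0"
    using underdetermined_system[OF V(1) F(1) V(2), of ?a] by blast
  have col: "(\<Sum>e\<in>F. if snd e = c then x e else 0) = 0" for c
  proof (cases "c \<in> snd ` F")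
    case True
    then have "(\<Sum>e\<in>F. ?a (Inr c) e * x e) = 0" by (intro x(2)) (auto simp: V_def)
    moreover have "(\<Sum>e\<in>F. ?a (Inr c) e * x e) = (\<Sum>e\<in>F. if snd e = c then x e else 0)"
      by (intro sum.cong) auto
    ultimately show ?thesis by simp
  qed (force intro!: sum.neutral)
  have row: "(\<Sum>e\<in>F. if fst e = i then x e else 0) = 0" if "i \<noteq> i0" for i
  proof (cases "i \<in> fst ` F")
    case True
    then have "(\<Sum>e\<in>F. ?a (Inl i) e * x e) = 0" using that by (intro x(2)) (auto simp: V_def)
    moreover have "(\<Sum>e\<in>F. ?a (Inl i) e * x e) = (\<Sum>e\<in>F. if fst e = i then x e else 0)"
      by (intro sum.cong) auto
    ultimately show ?thesis by simp
  qed (force intro!: sum.neutral)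
  have group: "(\<Sum>y\<in>f ` F. \<Sum>e\<in>F. if f e = y then x e else 0) = sum x F" for f :: "'a \<times> 'b \<Rightarrow> 'c"
    by (subst sum.image_gen[OF F(1), of x f]) (simp add: sum.inter_filter F(1))
  have "sum x F = 0" using group[of snd] col by simp
  then have "(\<Sum>i\<in>fst ` F. \<Sum>e\<in>F. if fst e = i then x e else 0) = 0" using group[of fst] by simp
  then have "(\<Sum>e\<in>F. if fst e = i0 then x e else 0) = 0"
    using i0 F(1) row by (subst (asm) sum.remove[of _ i0]) auto
  with row have "(\<Sum>e\<in>F. if fst e = i then x e else 0) = 0" for i by (cases "i = i0") simp_all
  with col x(1) show ?thesis by blast
qed

text \<open>Moving along a direction with zero margins, up to the first time a fractional entry becomes
  integral, preserves the margins and the integral entries.\<close>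

lemma integral_rounding:
  fixes z :: "'a \<times> 'b \<Rightarrow> real"
  assumes fin: "finite I" "finite C"
    and "\<And>i. i \<in> I \<Longrightarrow> (\<Sum>c\<in>C. z (i, c)) \<in> \<int>"
    and "\<And>c. c \<in> C \<Longrightarrow> (\<Sum>i\<in>I. z (i, c)) \<in> \<int>"
  shows "\<exists>y :: 'a \<times> 'b \<Rightarrow> int. (\<forall>e\<in>I \<times> C. \<lfloor>z e\<rfloor> \<le> y e \<and> y e \<le> \<lceil>z e\<rceil>) \<and>
    (\<forall>i\<in>I. (\<Sum>c\<in>C. real_of_int (y (i, c))) = (\<Sum>c\<in>C. z (i, c))) \<and>
    (\<forall>c\<in>C. (\<Sum>i\<in>I. real_of_int (y (i, c))) = (\<Sum>i\<in>I. z (i, c)))"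
  using assms(3,4)
proof (induction "card {e \<in> I \<times> C. z e \<notin> \<int>}" arbitrary: z rule: less_induct)
  case less
  define F where "F = {e \<in> I \<times> C. z e \<notin> \<int>}"
  have F: "finite F" using fin by (simp add: F_def)
  show ?case
  proof (cases "F = {}")
    case True
    then have "real_of_int \<lfloor>z e\<rfloor> = z e" if "e \<in> I \<times> C" for e
      proof -
      have "z e \<in> \<int>" using True that by (auto simp: F_def)
      then show ?thesis by (elim Ints_cases) simp
    qed
    then show ?thesis
      by (intro exI[of _ "\<lambda>e. \<lfloor>z e\<rfloor>"]) (auto intro!: sum.cong simp: floor_le_ceiling)
  next
    case False
    have "\<exists>e'\<in>F. e' \<noteq> e \<and> fst e' = fst e" if "e \<in> F" for e
      using another_non_integer[of C "\<lambda>c. z (fst e, c)" "snd e"] that fin less.prems(1)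
      by (force simp: F_def)
    moreover have "\<exists>e'\<in>F. e' \<noteq> e \<and> snd e' = snd e" if "e \<in> F" for e
      using another_non_integer[of I "\<lambda>i. z (i, snd e)" "fst e"] that fin less.prems(2)
      by (force simp: F_def)
    ultimately have "2 * card (fst ` F) \<le> card F" "2 * card (snd ` F) \<le> card F"
      by (auto intro!: twice_card_image_le F)
    then obtain x :: "'a \<times> 'b \<Rightarrow> real" where x: "\<exists>e\<in>F. x e \<noteq> 0"
      "\<And>i. (\<Sum>e\<in>F. if fst e = i then x e else 0) = 0"
      "\<And>c. (\<Sum>e\<in>F. if snd e = c then x e else 0) = 0"
      using zero_margins_perturbation[OF F False] by blast
    define w where "w e = (if e \<in> F then x e else 0)" for e
    have FIC: "F \<subseteq> I \<times> C" by (auto simp: F_def)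
    have rows: "(\<Sum>c\<in>C. w (i, c)) = 0" if "i \<in> I" for i
    proof -
      have "(\<Sum>c\<in>C. w (i, c)) = (\<Sum>e\<in>Pair i ` C. w e)"
        by (subst sum.reindex) (auto simp: inj_on_def)
      also have "\<dots> = (\<Sum>e\<in>{e \<in> F. fst e = i}. x e)"
        using FIC fin F by (intro sum.mono_neutral_cong_right) (auto simp: w_def)
      finally show ?thesis using x(2)[of i] F by (simp add: sum.inter_filter)
    qed
    have cols: "(\<Sum>i\<in>I. w (i, c)) = 0" if "c \<in> C" for c
    proof -
      have "(\<Sum>i\<in>I. w (i, c)) = (\<Sum>e\<in>(\<lambda>i. (i, c)) ` I. w e)"
        by (subst sum.reindex) (auto simp: inj_on_def)
      also have "\<dots> = (\<Sum>e\<in>{e \<in> F. snd e = c}. x e)"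
        using FIC fin F by (intro sum.mono_neutral_cong_right) (auto simp: w_def)
      finally show ?thesis using x(3)[of c] F by (simp add: sum.inter_filter)
    qed
    define G where "G = {e \<in> F. x e \<noteq> 0}"
    \<comment> \<open>\<open>\<tau> e\<close> is the time at which cell \<open>e\<close>, moving
      with velocity \<open>x e\<close>, reaches the next integer in its direction. At the minimum
      \<open>t\<close> of these times one more cell is integral, and no cell has passed the floor or
      ceiling of its original value.\<close>
    define \<tau> where "\<tau> e = ((if x e > 0 then \<lceil>z e\<rceil> else \<lfloor>z e\<rfloor>) - z e) / x e" for e
    define t where "t = Min (\<tau> ` G)"
    have G: "finite G" "G \<noteq> {}" using F x(1) by (auto simp: G_def)
    have frac: "\<lfloor>z e\<rfloor> < z e" "z e < \<lceil>z e\<rceil>" if "e \<in> F" for e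
    proof -
      have "z e \<noteq> of_int \<lfloor>z e\<rfloor>" "z e \<noteq> of_int \<lceil>z e\<rceil>"
        using that unfolding F_def by (metis (mono_tags, lifting) Ints_of_int mem_Collect_eq)+
      then show "\<lfloor>z e\<rfloor> < z e" "z e < \<lceil>z e\<rceil>"
        using of_int_floor_le[of "z e"] le_of_int_ceiling[of "z e"] by linarith+
    qed
    have "\<tau> e > 0" if "e \<in> G" for e
      using that frac[of e] by (auto simp: \<tau>_def G_def divide_pos_pos divide_neg_neg)
    then have "t > 0" using G by (simp add: t_def)
    have t_le: "t \<le> \<tau> e" if "e \<in> G" for e using that G by (simp add: t_def)
    have "t \<in> \<tau> ` G" using G by (simp add: t_def)
    then obtain g where g: "g \<in> G" "t = \<tau> g" by blast
    define z' where "z' e = z e + t * w e" for e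
    have bounds: "\<lfloor>z e\<rfloor> \<le> z' e \<and> z' e \<le> \<lceil>z e\<rceil>" for e
    proof (cases "e \<in> G")
      case True
      then have e: "e \<in> F" "x e \<noteq> 0" by (auto simp: G_def)
      show ?thesis
      proof (cases "x e > 0")
        case True
        then have "t * x e \<le> \<lceil>z e\<rceil> - z e" "t * x e > 0"
          using t_le[OF \<open>e \<in> G\<close>] \<open>t > 0\<close> by (simp_all add: \<tau>_def pos_le_divide_eq)
        with e(1) frac[of e] show ?thesis by (simp add: z'_def w_def)
      next
        case False
        then have "x e < 0" using e by simp
        then have "t * x e \<ge> \<lfloor>z e\<rfloor> - z e" "t * x e < 0"
          using t_le[OF \<open>e \<in> G\<close>] \<open>t > 0\<close> by (simp_all add: \<tau>_def neg_le_divide_eq mult_pos_neg)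
        with e(1) frac[of e] show ?thesis by (simp add: z'_def w_def)
      qed
    next
      case False
      then have "w e = 0" by (auto simp: G_def w_def)
      then show ?thesis by (simp add: z'_def)
    qed
    have "z' g \<in> \<int>"
      using g by (auto simp: z'_def w_def G_def \<tau>_def)
    moreover have "z' e \<in> \<int>" if "e \<in> I \<times> C" "z e \<in> \<int>" for e
      using that by (simp add: z'_def w_def F_def)
    ultimately have "{e \<in> I \<times> C. z' e \<notin> \<int>} \<subset> F"
      using g by (auto simp: F_def G_def)
    then have "card {e \<in> I \<times> C. z' e \<notin> \<int>} < card F"
      using F by (intro psubset_card_mono)
    moreover have r': "(\<Sum>c\<in>C. z' (i, c)) = (\<Sum>c\<in>C. z (i, c))" if "i \<in> I" for i
      using rows[OF that] by (simp add: z'_def sum.distrib flip: sum_distrib_left)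
    moreover have c': "(\<Sum>i\<in>I. z' (i, c)) = (\<Sum>i\<in>I. z (i, c))" if "c \<in> C" for c
      using cols[OF that] by (simp add: z'_def sum.distrib flip: sum_distrib_left)
    ultimately obtain y :: "'a \<times> 'b \<Rightarrow> int" where
      y: "\<forall>e\<in>I \<times> C. \<lfloor>z' e\<rfloor> \<le> y e \<and> y e \<le> \<lceil>z' e\<rceil>"
      "\<forall>i\<in>I. (\<Sum>c\<in>C. real_of_int (y (i, c))) = (\<Sum>c\<in>C. z' (i, c))"
      "\<forall>c\<in>C. (\<Sum>i\<in>I. real_of_int (y (i, c))) = (\<Sum>i\<in>I. z' (i, c))"
      using less.hyps[of z'] less.prems unfolding F_def by auto
    \<comment> \<open>At each cell the rounding interval of \<open>z'\<close> lies inside that of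
      \<open>z\<close>, so the bounds from the induction hypothesis carry over.\<close>
    have "\<lfloor>z e\<rfloor> \<le> \<lfloor>z' e\<rfloor> \<and> \<lceil>z' e\<rceil> \<le> \<lceil>z e\<rceil>" for e
      using bounds[of e] by (simp add: le_floor_iff ceiling_le_iff)
    with y(1) have "\<forall>e\<in>I \<times> C. \<lfloor>z e\<rfloor> \<le> y e \<and> y e \<le> \<lceil>z e\<rceil>" by (meson order_trans)
    with y(2,3) r' c' show ?thesis by (intro exI[of _ y]) simp
  qed
qed

text \<open>A dummy column \<open>None\<close> completes every row sum to an integer.\<close>

lemma row_rounding:
  fixes z :: "'a \<Rightarrow> 'b \<Rightarrow> real"
  assumes fin: "finite I" "finite C"
    and cols: "\<And>c. c \<in> C \<Longrightarrow> (\<Sum>i\<in>I. z i c) \<in> \<int>"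
  obtains y :: "'a \<Rightarrow> 'b \<Rightarrow> int" where
    "\<And>i c. i \<in> I \<Longrightarrow> c \<in> C \<Longrightarrow> \<lfloor>z i c\<rfloor> \<le> y i c \<and> y i c \<le> \<lceil>z i c\<rceil>"
    "\<And>c. c \<in> C \<Longrightarrow> (\<Sum>i\<in>I. real_of_int (y i c)) = (\<Sum>i\<in>I. z i c)"
    "\<And>i. i \<in> I \<Longrightarrow> \<lfloor>\<Sum>c\<in>C. z i c\<rfloor> \<le> (\<Sum>c\<in>C. y i c) \<and> (\<Sum>c\<in>C. y i c) \<le> \<lceil>\<Sum>c\<in>C. z i c\<rceil>"
proof -
  define s where "s i = (\<Sum>c\<in>C. z i c)" for i
  define z' where "z' = (\<lambda>(i, c). case c of None \<Rightarrow> \<lceil>s i\<rceil> - s i | Some c \<Rightarrow> z i c)"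
  define C' where "C' = insert None (Some ` C)"
  have sum': "(\<Sum>c\<in>C'. f c) = f None + (\<Sum>c\<in>C. f (Some c))" for f :: "_ \<Rightarrow> real"
    using fin by (simp add: C'_def sum.reindex)
  have row: "(\<Sum>c\<in>C'. z' (i, c)) = \<lceil>s i\<rceil>" for i
    by (simp add: sum' z'_def s_def)
  \<comment> \<open>The dummy column has an integral sum too: a sum of ceilings minus the total of
    \<open>z\<close>, which is a sum of integral column sums.\<close>
  have "(\<Sum>i\<in>I. s i) = (\<Sum>c\<in>C. \<Sum>i\<in>I. z i c)"
    unfolding s_def by (rule sum.swap)
  then have "(\<Sum>i\<in>I. s i) \<in> \<int>" using cols by (auto intro: Ints_sum)
  then have "(\<Sum>i\<in>I. z' (i, None)) \<in> \<int>"
    by (auto simp: z'_def sum_subtractf intro!: Ints_diff Ints_sum)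
  moreover have "(\<Sum>i\<in>I. z' (i, Some c)) = (\<Sum>i\<in>I. z i c)" for c by (simp add: z'_def)
  ultimately have col: "(\<Sum>i\<in>I. z' (i, c)) \<in> \<int>" if "c \<in> C'" for c
    using that cols by (cases c) (simp_all add: C'_def image_iff)
  have "finite C'" using fin by (simp add: C'_def)
  then obtain y :: "'a \<times> 'b option \<Rightarrow> int" where
    y: "\<forall>e\<in>I \<times> C'. \<lfloor>z' e\<rfloor> \<le> y e \<and> y e \<le> \<lceil>z' e\<rceil>"
    "\<forall>i\<in>I. (\<Sum>c\<in>C'. real_of_int (y (i, c))) = (\<Sum>c\<in>C'. z' (i, c))"
    "\<forall>c\<in>C'. (\<Sum>i\<in>I. real_of_int (y (i, c))) = (\<Sum>i\<in>I. z' (i, c))"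
    using integral_rounding[OF fin(1), of C' z'] row col by (force intro: Ints_of_int)
  show ?thesis
  proof (rule that[of "\<lambda>i c. y (i, Some c)"])
    fix i c assume "i \<in> I" "c \<in> C"
    then show "\<lfloor>z i c\<rfloor> \<le> y (i, Some c) \<and> y (i, Some c) \<le> \<lceil>z i c\<rceil>"
      using bspec[OF y(1), of "(i, Some c)"] by (simp add: C'_def z'_def)
  next
    fix c assume "c \<in> C"
    then show "(\<Sum>i\<in>I. real_of_int (y (i, Some c))) = (\<Sum>i\<in>I. z i c)"
      using y(3) by (simp add: C'_def z'_def)
  next
    fix i assume i: "i \<in> I"
    have "real_of_int (y (i, None) + (\<Sum>c\<in>C. y (i, Some c))) = real_of_int \<lceil>s i\<rceil>"
      using y(2) i row by (simp add: sum')
    then have "y (i, None) + (\<Sum>c\<in>C. y (i, Some c)) = \<lceil>s i\<rceil>" by linarith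
    \<comment> \<open>The dummy entry is 0 if \<open>s i\<close> is an integer and 0 or 1 otherwise,
      so removing it from the row sum \<open>\<lceil>s i\<rceil>\<close> leaves the floor or the
      ceiling of \<open>s i\<close>.\<close>
    moreover have "\<lfloor>\<lceil>s i\<rceil> - s i\<rfloor> \<le> y (i, None) \<and> y (i, None) \<le> \<lceil>\<lceil>s i\<rceil> - s i\<rceil>"
      using bspec[OF y(1), of "(i, None)"] i by (simp add: C'_def z'_def)
    ultimately show "\<lfloor>\<Sum>c\<in>C. z i c\<rfloor> \<le> (\<Sum>c\<in>C. y (i, Some c)) \<and> (\<Sum>c\<in>C. y (i, Some c)) \<le> \<lceil>\<Sum>c\<in>C. z i c\<rceil>"
      unfolding s_def[symmetric] by linarith
  qed
qed

text \<open>One of \<open>Suc q\<close> equal shares is split off: each edge of class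
  \<open>c\<close> has \<open>s c\<close> free hinges, and the fractional share
  \<open>X i c * s c / Suc q\<close> is rounded. Column sums are integral already and stay exact. A
  row sum moves by less than 1, and since \<open>L i\<close> and \<open>U i\<close> are integers,
  the share stays between them and the rest between \<open>q\<close> times them, so the splitting
  can be repeated.\<close>

lemma peel:
  fixes X :: "'a \<Rightarrow> 'b \<Rightarrow> nat" and s M :: "'b \<Rightarrow> nat" and L U :: "'a \<Rightarrow> int"
  assumes fin: "finite I" "finite C"
    and cols: "\<And>c. c \<in> C \<Longrightarrow> (\<Sum>i\<in>I. X i c) * s c = Suc q * M c"
    and s: "\<And>i c. i \<in> I \<Longrightarrow> c \<in> C \<Longrightarrow> s c \<le> Suc q \<or> X i c = 0"
    and rows: "\<And>i. i \<in> I \<Longrightarrow> int (Suc q) * L i \<le> int (\<Sum>c\<in>C. X i c * s c) \<and>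
      int (\<Sum>c\<in>C. X i c * s c) \<le> int (Suc q) * U i"
  obtains Y :: "'a \<Rightarrow> 'b \<Rightarrow> nat" where
    "\<And>i c. i \<in> I \<Longrightarrow> c \<in> C \<Longrightarrow> Y i c \<le> X i c"
    "\<And>c. c \<in> C \<Longrightarrow> (\<Sum>i\<in>I. Y i c) = M c"
    "\<And>i. i \<in> I \<Longrightarrow> L i \<le> int (\<Sum>c\<in>C. Y i c) \<and> int (\<Sum>c\<in>C. Y i c) \<le> U i"
    "\<And>i. i \<in> I \<Longrightarrow> int q * L i \<le> int (\<Sum>c\<in>C. X i c * s c) - int (\<Sum>c\<in>C. Y i c) \<and>
      int (\<Sum>c\<in>C. X i c * s c) - int (\<Sum>c\<in>C. Y i c) \<le> int q * U i"
proof -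
  define z where "z i c = real (X i c * s c) / real (Suc q)" for i c
  have col: "(\<Sum>i\<in>I. z i c) = real (M c)" if "c \<in> C" for c
  proof -
    have "(\<Sum>i\<in>I. z i c) = real ((\<Sum>i\<in>I. X i c) * s c) / real (Suc q)"
      by (simp add: z_def sum_distrib_right flip: sum_divide_distrib)
    then show ?thesis by (simp only: cols[OF that] of_nat_mult) (simp del: of_nat_Suc)
  qed
  then have ints: "(\<Sum>i\<in>I. z i c) \<in> \<int>" if "c \<in> C" for c using that by simp
  obtain y :: "'a \<Rightarrow> 'b \<Rightarrow> int" where
    y: "\<And>i c. i \<in> I \<Longrightarrow> c \<in> C \<Longrightarrow> \<lfloor>z i c\<rfloor> \<le> y i c \<and> y i c \<le> \<lceil>z i c\<rceil>"
    "\<And>c. c \<in> C \<Longrightarrow> (\<Sum>i\<in>I. real_of_int (y i c)) = (\<Sum>i\<in>I. z i c)"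
    "\<And>i. i \<in> I \<Longrightarrow> \<lfloor>\<Sum>c\<in>C. z i c\<rfloor> \<le> (\<Sum>c\<in>C. y i c) \<and> (\<Sum>c\<in>C. y i c) \<le> \<lceil>\<Sum>c\<in>C. z i c\<rceil>"
    by (rule row_rounding[of I C z, OF fin ints]) blast+
  have y0: "0 \<le> y i c" "y i c \<le> int (X i c)" if "i \<in> I" "c \<in> C" for i c
  proof -
    have "0 \<le> \<lfloor>z i c\<rfloor>" by (simp add: z_def)
    then show "0 \<le> y i c" using y(1)[OF that] by linarith
    \<comment> \<open>With at most \<open>Suc q\<close> free hinges per edge, the share is at most
      one hinge per edge.\<close>
    have "real (X i c * s c) \<le> real (X i c) * real (Suc q)"
    proof (cases "X i c = 0")
      case False
      then have "s c \<le> Suc q" using s[OF that] by simp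
      then show ?thesis by (simp only: of_nat_mult of_nat_le_iff mult_left_mono of_nat_0_le_iff)
    qed simp
    then have "z i c \<le> real (X i c)"
      by (simp add: z_def pos_divide_le_eq del: of_nat_Suc of_nat_mult)
    then have "\<lceil>z i c\<rceil> \<le> int (X i c)" by (simp add: ceiling_le_iff)
    then show "y i c \<le> int (X i c)" using y(1)[OF that] by linarith
  qed
  define Y where "Y i c = nat (y i c)" for i c
  have Y: "int (Y i c) = y i c" if "i \<in> I" "c \<in> C" for i c
    using y0[OF that] by (simp add: Y_def)
  have row: "int (\<Sum>c\<in>C. Y i c) = (\<Sum>c\<in>C. y i c)" if "i \<in> I" for i
    using Y that by simp
  define D where "D i = int (\<Sum>c\<in>C. X i c * s c)" for i
  \<comment> \<open>The rounding error is less than 1; clearing the denominator turns this into a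
    strict inequality between integers.\<close>
  have near: "\<bar>real_of_int (int (Suc q) * (\<Sum>c\<in>C. y i c) - D i)\<bar> < real (Suc q)" if "i \<in> I" for i
  proof -
    have "(\<Sum>c\<in>C. z i c) = real_of_int (D i) / real (Suc q)"
      by (simp add: z_def D_def flip: sum_divide_distrib)
    then have "\<bar>real_of_int (\<Sum>c\<in>C. y i c) - real_of_int (D i) / real (Suc q)\<bar> < 1"
      using y(3)[OF that] by linarith
    then have "\<bar>real_of_int (\<Sum>c\<in>C. y i c) - real_of_int (D i) / real (Suc q)\<bar> * real (Suc q) < real (Suc q)"
      by simp
    then have "\<bar>(real_of_int (\<Sum>c\<in>C. y i c) - real_of_int (D i) / real (Suc q)) * real (Suc q)\<bar> < real (Suc q)"
      by (simp only: abs_mult abs_of_nat)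
    moreover have "(real_of_int (\<Sum>c\<in>C. y i c) - real_of_int (D i) / real (Suc q)) * real (Suc q)
        = real_of_int (int (Suc q) * (\<Sum>c\<in>C. y i c) - D i)"
      by (simp add: field_simps del: of_int_sum)
    ultimately show ?thesis by simp
  qed
  have near: "\<bar>int (Suc q) * (\<Sum>c\<in>C. y i c) - D i\<bar> < int (Suc q)" if "i \<in> I" for i
    using near[OF that] by linarith
  have bnd: "L i \<le> y' \<and> y' \<le> U i \<and> int q * L i \<le> D i - y' \<and> D i - y' \<le> int q * U i"
    if i: "i \<in> I" and y': "y' = (\<Sum>c\<in>C. y i c)" for i y'
  proof -
    define Q where "Q = int q + 1"
    have Q: "Q \<ge> 1" "int (Suc q) = Q" "int q = Q - 1" by (auto simp: Q_def)
    have D: "Q * L i \<le> D i" "D i \<le> Q * U i" using rows[OF i] Q by (simp_all add: D_def)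
    have n: "Q * y' - D i < Q" "D i - Q * y' < Q" using near[OF i] unfolding Q y' by linarith+
    have "Q * L i < Q * (y' + 1)" "Q * y' < Q * (U i + 1)"
      using D n by (simp_all add: algebra_simps)
    then have "L i < y' + 1" "y' < U i + 1" using Q by (simp_all add: mult_less_cancel_left)
    \<comment> \<open>An integer bound is violated by at least 1. Scaled by \<open>Q\<close> and
      combined with \<open>Q * L i \<le> D i\<close>, this would make the scaled rounding error at
      least \<open>Q\<close>. The upper bound is symmetric.\<close>
    moreover have "int q * L i \<le> D i - y'"
    proof (rule ccontr)
      assume "\<not> ?thesis"
      then have 1: "D i - y' + 1 \<le> (Q - 1) * L i" using Q by simp
      have "Q * (D i - y' + 1) \<le> Q * ((Q - 1) * L i)" using 1 Q by (intro mult_left_mono) auto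
      also have "\<dots> \<le> (Q - 1) * D i" using D mult_left_mono[of "Q * L i" "D i" "Q - 1"] Q
        by (simp add: mult.left_commute)
      finally show False using n by (simp add: algebra_simps)
    qed
    moreover have "D i - y' \<le> int q * U i"
    proof (rule ccontr)
      assume "\<not> ?thesis"
      then have 1: "(Q - 1) * U i \<le> D i - y' - 1" using Q by simp
      have "(Q - 1) * D i \<le> Q * ((Q - 1) * U i)" using D mult_left_mono[of "D i" "Q * U i" "Q - 1"] Q
        by (simp add: mult.left_commute)
      also have "\<dots> \<le> Q * (D i - y' - 1)" using 1 Q by (intro mult_left_mono) auto
      finally show False using n by (simp add: algebra_simps)
    qed
    ultimately show ?thesis by linarith
  qed
  show ?thesis
  proof (rule that[of Y])
    show "Y i c \<le> X i c" if "i \<in> I" "c \<in> C" for i c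
      using y0[OF that] by (simp add: Y_def)
    show "(\<Sum>i\<in>I. Y i c) = M c" if "c \<in> C" for c
    proof -
      have "real (\<Sum>i\<in>I. Y i c) = (\<Sum>i\<in>I. real_of_int (y i c))"
        using y0(1) that by (simp add: Y_def)
      also have "\<dots> = real (M c)" using y(2) col that by simp
      finally show ?thesis by (simp only: of_nat_eq_iff)
    qed
    fix i assume i: "i \<in> I"
    note b = bnd[OF i row[OF i]]
    show "L i \<le> int (\<Sum>c\<in>C. Y i c) \<and> int (\<Sum>c\<in>C. Y i c) \<le> U i"
      using b by (simp only: simp_thms)
    show "int q * L i \<le> int (\<Sum>c\<in>C. X i c * s c) - int (\<Sum>c\<in>C. Y i c) \<and>
        int (\<Sum>c\<in>C. X i c * s c) - int (\<Sum>c\<in>C. Y i c) \<le> int q * U i"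
      using b unfolding D_def by (simp only: simp_thms)
  qed
qed

text \<open>Repeated use of \<open>peel\<close> with one free hinge per edge: each round cuts off
  the share of one vertex, and the rest satisfies the same hypotheses for one vertex fewer.\<close>

lemma even_split:
  fixes X :: "'a \<Rightarrow> 'b \<Rightarrow> nat" and M :: "'b \<Rightarrow> nat" and L U :: "'a \<Rightarrow> int"
  assumes fin: "finite I" "finite C"
    and "\<And>c. c \<in> C \<Longrightarrow> (\<Sum>i\<in>I. X i c) = p * M c"
    and "\<And>i. i \<in> I \<Longrightarrow> int p * L i \<le> int (\<Sum>c\<in>C. X i c) \<and> int (\<Sum>c\<in>C. X i c) \<le> int p * U i"
  shows "\<exists>Y. (\<forall>i\<in>I. \<forall>c\<in>C. (\<Sum>b=1..p. Y b i c) = X i c) \<and>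
    (\<forall>b\<in>{1..p}. \<forall>c\<in>C. (\<Sum>i\<in>I. Y b i c) = M c) \<and>
    (\<forall>b\<in>{1..p}. \<forall>i\<in>I. L i \<le> int (\<Sum>c\<in>C. Y b i c) \<and> int (\<Sum>c\<in>C. Y b i c) \<le> U i)"
  using assms(3,4)
proof (induction p arbitrary: X)
  case 0
  then have "\<forall>i\<in>I. \<forall>c\<in>C. X i c = 0" using fin by simp
  then show ?case by simp
next
  case (Suc p)
  have c: "(\<Sum>i\<in>I. X i c) * 1 = Suc p * M c" if "c \<in> C" for c
    using Suc.prems(1)[OF that] by simp
  have r: "int (Suc p) * L i \<le> int (\<Sum>c\<in>C. X i c * 1) \<and>
      int (\<Sum>c\<in>C. X i c * 1) \<le> int (Suc p) * U i" if "i \<in> I" for i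
    using Suc.prems(2)[OF that] by simp
  obtain Y0 :: "'a \<Rightarrow> 'b \<Rightarrow> nat" where
    Y0: "\<And>i c. i \<in> I \<Longrightarrow> c \<in> C \<Longrightarrow> Y0 i c \<le> X i c"
    "\<And>c. c \<in> C \<Longrightarrow> (\<Sum>i\<in>I. Y0 i c) = M c"
    "\<And>i. i \<in> I \<Longrightarrow> L i \<le> int (\<Sum>c\<in>C. Y0 i c) \<and> int (\<Sum>c\<in>C. Y0 i c) \<le> U i"
    "\<And>i. i \<in> I \<Longrightarrow> int p * L i \<le> int (\<Sum>c\<in>C. X i c * 1) - int (\<Sum>c\<in>C. Y0 i c) \<and>
      int (\<Sum>c\<in>C. X i c * 1) - int (\<Sum>c\<in>C. Y0 i c) \<le> int p * U i"
    by (rule peel[OF fin c _ r]) auto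
  have "(\<Sum>i\<in>I. X i c - Y0 i c) = p * M c" if "c \<in> C" for c
    using Y0(1,2) that Suc.prems(1)[OF that] by (simp add: sum_subtractf_nat)
  moreover have "int (\<Sum>c\<in>C. X i c - Y0 i c) = int (\<Sum>c\<in>C. X i c * 1) - int (\<Sum>c\<in>C. Y0 i c)"
    if "i \<in> I" for i
    using Y0(1) that by (simp add: sum_subtractf_nat sum_mono of_nat_diff)
  ultimately obtain Y where
    Y: "\<forall>i\<in>I. \<forall>c\<in>C. (\<Sum>b=1..p. Y b i c) = X i c - Y0 i c"
    "\<forall>b\<in>{1..p}. \<forall>c\<in>C. (\<Sum>i\<in>I. Y b i c) = M c"
    "\<forall>b\<in>{1..p}. \<forall>i\<in>I. L i \<le> int (\<Sum>c\<in>C. Y b i c) \<and> int (\<Sum>c\<in>C. Y b i c) \<le> U i"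
    using Suc.IH[of "\<lambda>i c. X i c - Y0 i c"] Y0(4) by auto
  define Y' where "Y' = Y(Suc p := Y0)"
  have "(\<Sum>b=1..Suc p. Y' b i c) = X i c" if "i \<in> I" "c \<in> C" for i c
  proof -
    have "(\<Sum>b=1..p. Y' b i c) = (\<Sum>b=1..p. Y b i c)"
      by (intro sum.cong) (auto simp: Y'_def)
    then show ?thesis using Y(1) Y0(1) that by (simp add: Y'_def)
  qed
  moreover have "(\<forall>c\<in>C. (\<Sum>i\<in>I. Y' b i c) = M c) \<and>
      (\<forall>i\<in>I. L i \<le> int (\<Sum>c\<in>C. Y' b i c) \<and> int (\<Sum>c\<in>C. Y' b i c) \<le> U i)"
    if "b \<in> {1..Suc p}" for b
  proof (cases "b = Suc p")
    case True
    then show ?thesis using Y0(2,3) by (simp add: Y'_def)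
  next
    case False
    then have "b \<in> {1..p}" using that by auto
    with False Y(2,3) show ?thesis by (simp add: Y'_def)
  qed
  ultimately show ?case by (intro exI[of _ Y']) blast
qed

subsection \<open>Transversals\<close>

text \<open>Transversals of every cardinality over a chosen set of parts: the possible vertex sets
  of an edge while only the parts in \<open>P\<close> have been detached.\<close>

definition partial_transversals :: "nat set \<Rightarrow> nat \<Rightarrow> (nat \<times> nat) set set" where
  "partial_transversals P p = {S. S \<subseteq> P \<times> {1..p} \<and> inj_on fst S}"

lemma finite_partial_transversals: "finite P \<Longrightarrow> finite (partial_transversals P p)"
  by (rule finite_subset[of _ "Pow (P \<times> {1..p})"]) (auto simp: partial_transversals_def)

lemma partial_transversals_insert:
  assumes "a \<notin> P"
  shows "partial_transversals (insert a P) p = partial_transversals P p \<union>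
    (\<lambda>(S, b). insert (a, b) S) ` (partial_transversals P p \<times> {1..p})" (is "?L = ?R")
proof (intro equalityI subsetI)
  fix S assume S: "S \<in> ?L"
  show "S \<in> ?R"
  proof (cases "\<exists>b. (a, b) \<in> S")
    case True
    then obtain b where b: "(a, b) \<in> S" by blast
    have S': "S \<subseteq> insert a P \<times> {1..p}" "inj_on fst S"
      using S by (auto simp: partial_transversals_def)
    have "x = (a, b)" if "x \<in> S" "fst x = a" for x
      using inj_onD[OF S'(2), of x "(a, b)"] that b by simp
    then have "S - {(a, b)} \<subseteq> P \<times> {1..p}" using S'(1) by fastforce
    then have "S - {(a, b)} \<in> partial_transversals P p"
      using inj_on_subset[OF S'(2)] by (auto simp: partial_transversals_def)
    moreover have "b \<in> {1..p}" using b S'(1) by auto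
    ultimately have "(S - {(a, b)}, b) \<in> partial_transversals P p \<times> {1..p}" by simp
    from imageI[OF this, of "\<lambda>(S, b). insert (a, b) S"] show ?thesis
      using b by (simp only: case_prod_conv insert_Diff UnI2)
  next
    case False
    then show ?thesis using S by (auto simp: partial_transversals_def)
  qed
next
  fix S assume "S \<in> ?R"
  then show "S \<in> ?L"
    using assms by (auto simp: partial_transversals_def inj_on_def)
qed

text \<open>The recursion over the parts. No member of \<open>partial_transversals P p\<close> meets
  part \<open>a\<close>, so the sets with and without a vertex in \<open>a\<close> are disjoint
  families, and \<open>insert (a, b) S\<close> determines \<open>S\<close> and
  \<open>b\<close>.\<close>

lemma sum_partial_transversals_insert:
  assumes "finite P" "a \<notin> P"
  shows "sum f (partial_transversals (insert a P) p) =
    (\<Sum>S\<in>partial_transversals P p. f S + (\<Sum>b=1..p. f (insert (a, b) S)))"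
proof -
  let ?T = "partial_transversals P p"
  have a: "(a, b) \<notin> S" if "S \<in> ?T" for S b
    using that assms by (auto simp: partial_transversals_def)
  have inj: "inj_on (\<lambda>(S, b). insert (a, b) S) (?T \<times> {1..p})"
  proof (rule inj_onI, clarify)
    fix S b S' b' assume "S \<in> ?T" "S' \<in> ?T" and eq: "insert (a, b) S = insert (a, b') S'"
    then have "(a, b) = (a, b')" using a by blast
    with eq a[OF \<open>S \<in> ?T\<close>] a[OF \<open>S' \<in> ?T\<close>] show "S = S' \<and> b = b'" by (metis insert_ident prod.inject)
  qed
  have "sum f (partial_transversals (insert a P) p) =
      sum f ?T + sum f ((\<lambda>(S, b). insert (a, b) S) ` (?T \<times> {1..p}))"
    unfolding partial_transversals_insert[OF assms(2)]
    using a assms(1) by (intro sum.union_disjoint) (auto simp: finite_partial_transversals)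
  also have "\<dots> = sum f ?T + (\<Sum>S\<in>?T. \<Sum>b=1..p. f (insert (a, b) S))"
    by (simp only: sum.reindex[OF inj] sum.cartesian_product) (simp add: case_prod_unfold o_def)
  finally show ?thesis by (simp add: sum.distrib)
qed

text \<open>Written as a sum of indicators, the cardinality obeys the recursion over the parts, and
  the induction step is Pascal's rule.\<close>

lemma card_partial_transversals:
  assumes "finite P"
  shows "card {S \<in> partial_transversals P p. card S = s} = (card P choose s) * p ^ s"
  using assms
proof (induction P arbitrary: s rule: finite_induct)
  case empty
  have "{S \<in> partial_transversals {} p. card S = s} = (if s = 0 then {{}} else {})"
    by (auto simp: partial_transversals_def)
  then show ?case by simp
next
  case (insert a P)
  let ?T = "partial_transversals P p"
  have eq: "card {S \<in> partial_transversals Q p. card S = s} =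
      (\<Sum>S\<in>partial_transversals Q p. if card S = s then 1 else 0)" if "finite Q" for Q s
    using that by (simp add: finite_partial_transversals flip: sum.inter_filter)
  have card: "card (insert (a, b) S) = Suc (card S)" if "S \<in> ?T" for S b
  proof -
    have "finite S" "(a, b) \<notin> S"
      using that insert by (auto simp: partial_transversals_def intro: finite_subset)
    then show ?thesis by simp
  qed
  have "card {S \<in> partial_transversals (insert a P) p. card S = s} =
      (\<Sum>S\<in>?T. (if card S = s then 1 else 0) + p * (if Suc (card S) = s then 1 else 0))"
    using insert.hyps by (simp add: eq sum_partial_transversals_insert card cong: sum.cong)
  also have "\<dots> = (\<Sum>S\<in>?T. if card S = s then 1 else 0) + p * (\<Sum>S\<in>?T. if Suc (card S) = s then 1 else 0)"
    by (simp only: sum.distrib sum_distrib_left)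
  also have "\<dots> = (card (insert a P) choose s) * p ^ s"
  proof (cases s)
    case 0
    then show ?thesis using insert.IH[of 0] insert.hyps by (simp add: eq)
  next
    case (Suc s')
    then show ?thesis using insert.IH[of s] insert.IH[of s'] insert.hyps
      by (simp add: eq algebra_simps)
  qed
  finally show ?case .
qed

lemma transversals_eq: "transversals n p s = {S \<in> partial_transversals {1..n} p. card S = s}"
  by (auto simp: transversals_def partial_transversals_def)

subsection \<open>Detaching the parts\<close>

text \<open>The number of ways to extend a partial transversal of cardinality \<open>t\<close> to one of cardinality \<open>s\<close>
  by vertices from \<open>q\<close> further parts of size \<open>p\<close>.\<close>

definition completions :: "nat \<Rightarrow> nat \<Rightarrow> nat \<Rightarrow> nat \<Rightarrow> nat" where
  "completions p q s t = (if t \<le> s then (q choose (s - t)) * p ^ (s - t) else 0)"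

text \<open>A completion either skips the next part or uses one of its \<open>p\<close>
  vertices.\<close>

lemma completions_Suc:
  "completions p (Suc q) s t = completions p q s t + p * completions p q s (Suc t)"
proof (cases "t < s")
  case True
  then have "s - t = Suc (s - Suc t)" by simp
  with True show ?thesis by (simp add: completions_def algebra_simps)
qed (auto simp: completions_def)

lemma completions_eq_0: "q < s - t \<Longrightarrow> completions p q s t = 0"
  by (simp add: completions_def binomial_eq_0)

text \<open>Both sides count completions with one marked new vertex: marked after completing, or
  chosen first by its part and its position in it. This supplies the column hypothesis of
  \<open>peel\<close>.\<close>

lemma completions_mult:
  "completions p (Suc q) s t * (s - t) = Suc q * (p * completions p q s (Suc t))"
proof (cases "t < s")
  case True
  then have e: "s - t = Suc (s - Suc t)" by simp
  have b: "(Suc q choose Suc (s - Suc t)) * Suc (s - Suc t) = Suc q * (q choose (s - Suc t))"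
    using Suc_times_binomial_eq[of q "s - Suc t"] by (simp only: mult.commute)
  have "completions p (Suc q) s t * (s - t) =
      ((Suc q choose Suc (s - Suc t)) * Suc (s - Suc t)) * (p * p ^ (s - Suc t))"
    using True by (simp only: completions_def e) (simp add: algebra_simps)
  also have "\<dots> = Suc q * (p * ((q choose (s - Suc t)) * p ^ (s - Suc t)))"
    unfolding b by (simp only: mult_ac)
  finally show ?thesis using True by (simp add: completions_def)
qed (auto simp: completions_def)

text \<open>\<open>X i j S\<close> is the number of edges of colour \<open>i\<close> and final size \<open>h j\<close> whose vertices in the first
  \<open>t\<close> parts form the set \<open>S\<close>; the other \<open>h j - card S\<close> hinges still sit at the amalgamated vertex.\<close>

lemma partial_transversals_coloring:
  fixes A :: "nat \<Rightarrow> nat \<Rightarrow> nat" and L U :: "nat \<Rightarrow> int" and lam h :: "nat \<Rightarrow> nat"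
  assumes I: "finite I" and J: "finite J" and "t \<le> n"
    and total: "\<And>j. j \<in> J \<Longrightarrow> (\<Sum>i\<in>I. A i j) = lam j * ((n choose h j) * p ^ h j)"
    and bounds: "\<And>i. i \<in> I \<Longrightarrow> int n * (int p * L i) \<le> int (\<Sum>j\<in>J. A i j * h j) \<and>
      int (\<Sum>j\<in>J. A i j * h j) \<le> int n * (int p * U i)"
  shows "\<exists>X. (\<forall>j\<in>J. \<forall>S\<in>partial_transversals {1..t} p.
        (\<Sum>i\<in>I. X i j S) = lam j * completions p (n - t) (h j) (card S)) \<and>
    (\<forall>i\<in>I. \<forall>v\<in>{1..t} \<times> {1..p}.
        L i \<le> int (\<Sum>j\<in>J. \<Sum>S\<in>partial_transversals {1..t} p. if v \<in> S then X i j S else 0) \<and>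
        int (\<Sum>j\<in>J. \<Sum>S\<in>partial_transversals {1..t} p. if v \<in> S then X i j S else 0) \<le> U i) \<and>
    (\<forall>i\<in>I. int (n - t) * (int p * L i) \<le>
          int (\<Sum>j\<in>J. \<Sum>S\<in>partial_transversals {1..t} p. X i j S * (h j - card S)) \<and>
        int (\<Sum>j\<in>J. \<Sum>S\<in>partial_transversals {1..t} p. X i j S * (h j - card S))
          \<le> int (n - t) * (int p * U i))"
  using \<open>t \<le> n\<close>
proof (induction t)
  case 0
  \<comment> \<open>With no part detached, the empty set is the only vertex set, and
    \<open>A\<close> itself counts the edges, all of whose hinges are amalgamated.\<close>
  have "partial_transversals {} p = {{}}" by (auto simp: partial_transversals_def)
  then show ?case using total bounds
    by (intro exI[of _ "\<lambda>i j S. A i j"]) (simp add: completions_def)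
next
  case (Suc t)
  let ?T = "partial_transversals {1..t} p"
  define a where "a = Suc t"
  define q where "q = n - Suc t"
  have nt: "n - t = Suc q" using Suc.prems by (simp add: q_def)
  have a: "a \<notin> {1..t}" "{1..Suc t} = insert a {1..t}" by (auto simp: a_def)
  have T: "finite S" "(a, b) \<notin> S" if "S \<in> ?T" for S b
    using that a by (auto simp: partial_transversals_def intro: finite_subset)
  from Suc.IH Suc.prems obtain X where
    X1: "\<And>j S. j \<in> J \<Longrightarrow> S \<in> ?T \<Longrightarrow> (\<Sum>i\<in>I. X i j S) = lam j * completions p (Suc q) (h j) (card S)" and
    X2: "\<And>i v. i \<in> I \<Longrightarrow> v \<in> {1..t} \<times> {1..p} \<Longrightarrow>
      L i \<le> int (\<Sum>j\<in>J. \<Sum>S\<in>?T. if v \<in> S then X i j S else 0) \<and>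
      int (\<Sum>j\<in>J. \<Sum>S\<in>?T. if v \<in> S then X i j S else 0) \<le> U i" and
    X3: "\<And>i. i \<in> I \<Longrightarrow>
      int (Suc q) * (int p * L i) \<le> int (\<Sum>j\<in>J. \<Sum>S\<in>?T. X i j S * (h j - card S)) \<and>
      int (\<Sum>j\<in>J. \<Sum>S\<in>?T. X i j S * (h j - card S)) \<le> int (Suc q) * (int p * U i)"
    unfolding nt by force
  define C where "C = J \<times> ?T"
  have C: "finite C" using J by (simp add: C_def finite_partial_transversals)
  have sumC: "(\<Sum>c\<in>C. f (fst c) (snd c)) = (\<Sum>j\<in>J. \<Sum>S\<in>?T. f j S)" for f :: "nat \<Rightarrow> (nat \<times> nat) set \<Rightarrow> nat"
    by (simp add: C_def sum.cartesian_product case_prod_unfold)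
  define N where "N c = lam (fst c) * completions p q (h (fst c)) (Suc (card (snd c)))"
    for c :: "nat \<times> (nat \<times> nat) set"
  define x where "x i c = X i (fst c) (snd c)" for i c
  define s where "s c = h (fst c) - card (snd c)" for c :: "nat \<times> (nat \<times> nat) set"
  have x1: "(\<Sum>i\<in>I. x i c) = lam (fst c) * completions p (Suc q) (h (fst c)) (card (snd c))"
    if "c \<in> C" for c
    using that X1 by (auto simp: C_def x_def)
  have "(\<Sum>i\<in>I. x i c) * s c = Suc q * (p * N c)" if "c \<in> C" for c
    unfolding x1[OF that] s_def mult.assoc completions_mult N_def by (simp only: mult_ac)
  \<comment> \<open>Edges with more free hinges than there are parts left have no completion, so
    such a class is empty.\<close>
  moreover have "s c \<le> Suc q \<or> x i c = 0" if "i \<in> I" "c \<in> C" for i c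
  proof (rule disjCI)
    assume "x i c \<noteq> 0"
    then have "(\<Sum>i\<in>I. x i c) \<noteq> 0" using I that(1) by auto
    then have "completions p (Suc q) (h (fst c)) (card (snd c)) \<noteq> 0"
      unfolding x1[OF that(2)] by simp
    then show "s c \<le> Suc q"
      unfolding s_def using completions_eq_0 not_le by blast
  qed
  moreover have x3: "int (Suc q) * (int p * L i) \<le> int (\<Sum>c\<in>C. x i c * s c) \<and>
      int (\<Sum>c\<in>C. x i c * s c) \<le> int (Suc q) * (int p * U i)" if "i \<in> I" for i
    using X3[OF that] sumC[of "\<lambda>j S. X i j S * (h j - card S)"] by (simp add: x_def s_def)
  \<comment> \<open>\<open>Y i c\<close> counts the edges of colour \<open>i\<close> in class
    \<open>c\<close> that get a vertex in the new part; \<open>Z\<close> then distributes them among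
    its \<open>p\<close> vertices.\<close>
  ultimately obtain Y :: "nat \<Rightarrow> nat \<times> (nat \<times> nat) set \<Rightarrow> nat" where
    Y: "\<And>i c. i \<in> I \<Longrightarrow> c \<in> C \<Longrightarrow> Y i c \<le> x i c"
    "\<And>c. c \<in> C \<Longrightarrow> (\<Sum>i\<in>I. Y i c) = p * N c"
    "\<And>i. i \<in> I \<Longrightarrow> int p * L i \<le> int (\<Sum>c\<in>C. Y i c) \<and> int (\<Sum>c\<in>C. Y i c) \<le> int p * U i"
    "\<And>i. i \<in> I \<Longrightarrow> int q * (int p * L i) \<le> int (\<Sum>c\<in>C. x i c * s c) - int (\<Sum>c\<in>C. Y i c) \<and>
      int (\<Sum>c\<in>C. x i c * s c) - int (\<Sum>c\<in>C. Y i c) \<le> int q * (int p * U i)"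
    using peel[OF I C, of x s q "\<lambda>c. p * N c" "\<lambda>i. int p * L i" "\<lambda>i. int p * U i"] by blast
  obtain Z where
    Z: "\<And>i c. i \<in> I \<Longrightarrow> c \<in> C \<Longrightarrow> (\<Sum>b=1..p. Z b i c) = Y i c"
    "\<And>b c. b \<in> {1..p} \<Longrightarrow> c \<in> C \<Longrightarrow> (\<Sum>i\<in>I. Z b i c) = N c"
    "\<And>b i. b \<in> {1..p} \<Longrightarrow> i \<in> I \<Longrightarrow> L i \<le> int (\<Sum>c\<in>C. Z b i c) \<and> int (\<Sum>c\<in>C. Z b i c) \<le> U i"
    using even_split[OF I C Y(2,3)] by blast
  define X' where "X' i j S = (if \<exists>b. (a, b) \<in> S
      then Z (THE b. (a, b) \<in> S) i (j, {v \<in> S. fst v \<noteq> a}) else X i j S - Y i (j, S))" for i j S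
  have X'_old: "X' i j S = X i j S - Y i (j, S)" if "S \<in> ?T" for i j S
    using T(2)[OF that] by (simp add: X'_def)
  have X'_new: "X' i j (insert (a, b) S) = Z b i (j, S)" if "S \<in> ?T" for i j b S
  proof -
    have "{v \<in> insert (a, b) S. fst v \<noteq> a} = S" using T(2)[OF that] by auto
    moreover have "(THE b'. (a, b') \<in> insert (a, b) S) = b" using T(2)[OF that] by auto
    moreover have "\<exists>b'. (a, b') \<in> insert (a, b) S" by blast
    ultimately show ?thesis by (simp only: X'_def if_True)
  qed
  have card': "card (insert (a, b) S) = Suc (card S)" if "S \<in> ?T" for S b
    using T[OF that] by simp
  have le: "Y i (j, S) \<le> X i j S" if "i \<in> I" "j \<in> J" "S \<in> ?T" for i j S
    using Y(1)[of i "(j, S)"] that by (simp add: C_def x_def)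
  have sumZ: "(\<Sum>b=1..p. Z b i (j, S)) = Y i (j, S)" if "i \<in> I" "j \<in> J" "S \<in> ?T" for i j S
    using Z(1) that by (simp add: C_def)
  have split: "sum f (partial_transversals {1..Suc t} p) =
      (\<Sum>S\<in>?T. f S + (\<Sum>b=1..p. f (insert (a, b) S)))" for f :: "_ \<Rightarrow> nat"
    unfolding a(2) by (rule sum_partial_transversals_insert[OF _ a(1)]) simp
  have 1: "(\<Sum>i\<in>I. X' i j S) = lam j * completions p q (h j) (card S)"
    if j: "j \<in> J" and S: "S \<in> partial_transversals {1..Suc t} p" for j S
  proof -
    from S consider "S \<in> ?T" | S' b where "S' \<in> ?T" "b \<in> {1..p}" "S = insert (a, b) S'"
      unfolding a(2) partial_transversals_insert[OF a(1)] by auto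
    then show ?thesis
    proof cases
      case 1
      have "(\<Sum>i\<in>I. X' i j S) = (\<Sum>i\<in>I. X i j S) - (\<Sum>i\<in>I. Y i (j, S))"
        using le j 1 by (simp add: X'_old sum_subtractf_nat)
      also have "\<dots> = lam j * completions p (Suc q) (h j) (card S) - p * N (j, S)"
        using X1 Y(2) j 1 by (simp add: C_def)
      finally show ?thesis by (simp add: completions_Suc N_def algebra_simps)
    next
      case 2
      then show ?thesis using Z(2) j by (simp add: X'_new card' C_def N_def)
    qed
  qed
  have 2: "L i \<le> int (\<Sum>j\<in>J. \<Sum>S\<in>partial_transversals {1..Suc t} p. if v \<in> S then X' i j S else 0) \<and>
      int (\<Sum>j\<in>J. \<Sum>S\<in>partial_transversals {1..Suc t} p. if v \<in> S then X' i j S else 0) \<le> U i"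
    if i: "i \<in> I" and v: "v \<in> {1..Suc t} \<times> {1..p}" for i v
  proof (cases "fst v = a")
    case True
    then obtain b where b: "v = (a, b)" "b \<in> {1..p}" using v by (cases v) auto
    \<comment> \<open>A class reaches the new vertex \<open>(a, b)\<close> only through
      \<open>insert (a, b) S\<close>, so the degree there is a row sum of
      \<open>Z b\<close>.\<close>
    have "(\<Sum>j\<in>J. \<Sum>S\<in>partial_transversals {1..Suc t} p. if v \<in> S then X' i j S else 0) =
        (\<Sum>j\<in>J. \<Sum>S\<in>?T. Z b i (j, S))"
      unfolding split
    proof (intro sum.cong refl)
      fix j S assume "S \<in> ?T"
      then have "(\<Sum>b'=1..p. if v \<in> insert (a, b') S then X' i j (insert (a, b') S) else 0) =
          (\<Sum>b'=1..p. if b = b' then Z b' i (j, S) else 0)"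
        using T(2) b by (intro sum.cong) (auto simp: X'_new)
      also have "\<dots> = Z b i (j, S)" using b(2) by simp
      finally show "(if v \<in> S then X' i j S else 0) +
          (\<Sum>b'=1..p. if v \<in> insert (a, b') S then X' i j (insert (a, b') S) else 0) = Z b i (j, S)"
        using T(2)[OF \<open>S \<in> ?T\<close>] b by simp
    qed
    also have "\<dots> = (\<Sum>c\<in>C. Z b i c)" using sumC[of "\<lambda>j S. Z b i (j, S)"] by simp
    finally show ?thesis using Z(3)[OF b(2) i] by simp
  next
    case False
    then have v': "v \<in> {1..t} \<times> {1..p}" using v by (auto simp: a_def)
    \<comment> \<open>All sets into which a class is split contain \<open>v\<close> exactly if the
      old set does, so degrees at earlier vertices do not change.\<close>
    have "(\<Sum>j\<in>J. \<Sum>S\<in>partial_transversals {1..Suc t} p. if v \<in> S then X' i j S else 0) =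
        (\<Sum>j\<in>J. \<Sum>S\<in>?T. if v \<in> S then X i j S else 0)"
      unfolding split
    proof (intro sum.cong refl)
      fix j S assume j: "j \<in> J" and S: "S \<in> ?T"
      have "v \<in> insert (a, b) S \<longleftrightarrow> v \<in> S" for b using False by auto
      then show "(if v \<in> S then X' i j S else 0) +
          (\<Sum>b=1..p. if v \<in> insert (a, b) S then X' i j (insert (a, b) S) else 0) =
          (if v \<in> S then X i j S else 0)"
        using le[OF i j S] sumZ[OF i j S] S by (simp add: X'_old X'_new)
    qed
    with X2[OF i v'] show ?thesis by simp
  qed
  have 3: "int q * (int p * L i) \<le>
        int (\<Sum>j\<in>J. \<Sum>S\<in>partial_transversals {1..Suc t} p. X' i j S * (h j - card S)) \<and>
      int (\<Sum>j\<in>J. \<Sum>S\<in>partial_transversals {1..Suc t} p. X' i j S * (h j - card S))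
        \<le> int q * (int p * U i)" if i: "i \<in> I" for i
  proof -
    \<comment> \<open>Each edge that enters the new part uses up exactly one of its amalgamated
      hinges.\<close>
    have "X' i j S * (h j - card S) +
        (\<Sum>b=1..p. X' i j (insert (a, b) S) * (h j - card (insert (a, b) S))) + Y i (j, S)
        = X i j S * (h j - card S)" if j: "j \<in> J" and S: "S \<in> ?T" for j S
    proof -
      have "(\<Sum>b=1..p. X' i j (insert (a, b) S) * (h j - card (insert (a, b) S))) =
          Y i (j, S) * (h j - Suc (card S))"
        using sumZ[OF i j S] S by (simp add: X'_new card' flip: sum_distrib_right)
      \<comment> \<open>Truncated subtraction would spoil this balance for edges without free
        hinges; \<open>N\<close> vanishes on their classes, so none of them is moved.\<close>
      moreover have "Y i (j, S) = 0" if "h j \<le> card S"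
      proof -
        have "(\<Sum>i\<in>I. Y i (j, S)) = 0" using Y(2) j S that by (simp add: C_def N_def completions_def)
        then show ?thesis using I i by simp
      qed
      ultimately show ?thesis
      proof (cases "h j \<le> card S")
        case False
        then obtain d where d: "h j - card S = Suc d" "h j - Suc (card S) = d"
          by (metis Suc_diff_Suc not_le)
        obtain w where w: "X i j S = Y i (j, S) + w" using le[OF i j S] le_Suc_ex by blast
        with \<open>_ = Y i (j, S) * _\<close> d S show ?thesis by (simp add: X'_old algebra_simps)
      qed (use S in \<open>simp add: X'_old\<close>)
    qed
    then have "(\<Sum>j\<in>J. \<Sum>S\<in>?T. X' i j S * (h j - card S) +
        (\<Sum>b=1..p. X' i j (insert (a, b) S) * (h j - card (insert (a, b) S))) + Y i (j, S))
        = (\<Sum>j\<in>J. \<Sum>S\<in>?T. X i j S * (h j - card S))"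
      by (intro sum.cong refl)
    then have "(\<Sum>j\<in>J. \<Sum>S\<in>partial_transversals {1..Suc t} p. X' i j S * (h j - card S)) +
        (\<Sum>j\<in>J. \<Sum>S\<in>?T. Y i (j, S)) = (\<Sum>j\<in>J. \<Sum>S\<in>?T. X i j S * (h j - card S))"
      unfolding split by (simp only: sum.distrib)
    then have "(\<Sum>j\<in>J. \<Sum>S\<in>partial_transversals {1..Suc t} p. X' i j S * (h j - card S)) +
        (\<Sum>c\<in>C. Y i c) = (\<Sum>c\<in>C. x i c * s c)"
      using sumC[of "\<lambda>j S. X i j S * (h j - card S)"] sumC[of "\<lambda>j S. Y i (j, S)"]
      by (simp add: x_def s_def)
    then have "int (\<Sum>j\<in>J. \<Sum>S\<in>partial_transversals {1..Suc t} p. X' i j S * (h j - card S)) =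
        int (\<Sum>c\<in>C. x i c * s c) - int (\<Sum>c\<in>C. Y i c)"
      by linarith
    then show ?thesis using Y(4)[OF i] by simp
  qed
  show ?case
    unfolding q_def[symmetric]
    by (intro exI[of _ X'] conjI ballI;
        (rule 1 2[THEN conjunct1] 2[THEN conjunct2] 3[THEN conjunct1] 3[THEN conjunct2]; assumption))
qed

subsection \<open>Degrees and colour classes\<close>

lemma card_transversals: "card (transversals n p s) = (n choose s) * p ^ s"
  unfolding transversals_eq by (simp add: card_partial_transversals)

text \<open>Removing \<open>v\<close> leaves an arbitrary transversal of cardinality
  \<open>s - 1\<close> over the other \<open>n - 1\<close> parts.\<close>

lemma card_transversals_containing:
  assumes v: "v \<in> {1..n} \<times> {1..p}" and "s \<ge> 1"
  shows "card {S \<in> transversals n p s. v \<in> S} = ((n - 1) choose (s - 1)) * p ^ (s - 1)"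
proof -
  obtain a b where ab: "v = (a, b)" "a \<in> {1..n}" "b \<in> {1..p}" using v by auto
  define P where "P = {1..n} - {a}"
  have P: "finite P" "a \<notin> P" "{1..n} = insert a P" "card P = n - 1"
    using ab(2) by (auto simp: P_def)
  let ?T = "partial_transversals P p"
  have T: "finite S" "(a, b') \<notin> S" if "S \<in> ?T" for S b'
    using that P by (auto simp: partial_transversals_def intro: finite_subset)
  have "card {S \<in> transversals n p s. v \<in> S} =
      (\<Sum>S\<in>partial_transversals (insert a P) p. of_bool (card S = s \<and> v \<in> S))"
    unfolding transversals_eq P(3) using P(1)
    by (simp add: finite_partial_transversals Int_def conj_ac)
  also have "\<dots> = (\<Sum>S\<in>?T. of_bool (card S = s \<and> v \<in> S) +
      (\<Sum>b'=1..p. of_bool (card (insert (a, b') S) = s \<and> v \<in> insert (a, b') S)))"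
    by (rule sum_partial_transversals_insert[OF P(1,2)])
  also have "\<dots> = (\<Sum>S\<in>?T. of_bool (card S = s - 1))"
  proof (intro sum.cong refl)
    fix S assume S: "S \<in> ?T"
    have "(\<Sum>b'=1..p. of_bool (card (insert (a, b') S) = s \<and> v \<in> insert (a, b') S)) =
        (\<Sum>b'=1..p. if b = b' then of_bool (Suc (card S) = s) else 0 :: nat)"
      using T[OF S] ab(1) by (intro sum.cong) auto
    also have "\<dots> = of_bool (Suc (card S) = s)" using ab(3) by simp
    finally show "of_bool (card S = s \<and> v \<in> S) +
        (\<Sum>b'=1..p. of_bool (card (insert (a, b') S) = s \<and> v \<in> insert (a, b') S)) =
        (of_bool (card S = s - 1) :: nat)"
      using T[OF S] ab(1) \<open>s \<ge> 1\<close> by (auto simp: of_bool_def)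
  qed
  also have "\<dots> = card {S \<in> ?T. card S = s - 1}"
    using P(1) by (simp add: finite_partial_transversals Int_def)
  finally show ?thesis using card_partial_transversals[OF P(1)] P(4) by simp
qed

text \<open>The colours get consecutive blocks of \<open>{1..N}\<close>. This turns prescribed
  numbers per colour into a colouring of parallel edges.\<close>

lemma coloring_with_class_sizes:
  fixes x :: "nat \<Rightarrow> nat"
  assumes "(\<Sum>i=1..k. x i) = N"
  shows "\<exists>g. (\<forall>c\<in>{1..N}. g c \<in> {1..k}) \<and> (\<forall>i\<in>{1..k}. card {c \<in> {1..N}. g c = i} = x i)"
  using assms
proof (induction k arbitrary: N)
  case 0
  then show ?case by simp
next
  case (Suc k)
  define N' where "N' = (\<Sum>i=1..k. x i)"
  have N: "N = N' + x (Suc k)" using Suc.prems by (simp add: N'_def)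
  obtain g where g: "\<And>c. c \<in> {1..N'} \<Longrightarrow> g c \<in> {1..k}"
    "\<And>i. i \<in> {1..k} \<Longrightarrow> card {c \<in> {1..N'}. g c = i} = x i"
    using Suc.IH[OF N'_def[symmetric]] by blast
  define g' where "g' c = (if c \<le> N' then g c else Suc k)" for c
  have "g' c \<in> {1..Suc k}" if "c \<in> {1..N}" for c
    using g(1)[of c] that by (auto simp: g'_def)
  moreover have "card {c \<in> {1..N}. g' c = i} = x i" if "i \<in> {1..Suc k}" for i
  proof (cases "i = Suc k")
    case True
    have "{c \<in> {1..N}. g' c = i} = {N' + 1..N}"
      using g(1) True by (fastforce simp: g'_def split: if_splits)
    then show ?thesis using N True by simp
  next
    case False
    then have "{c \<in> {1..N}. g' c = i} = {c \<in> {1..N'}. g c = i}"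
      using N by (auto simp: g'_def split: if_splits)
    then show ?thesis using g(2) that False by simp
  qed
  ultimately show ?case by blast
qed

text \<open>Stated for arbitrary \<open>C\<close> to cover both \<open>LamK\<close>, where
  \<open>C j S = {1..lam j}\<close>, and its colour classes, where \<open>C j S\<close> consists of
  the copies of one colour.\<close>

lemma degree_transversal_hypergraph:
  fixes m :: nat
  assumes "\<And>j S. j \<in> {1..m} \<Longrightarrow> S \<in> transversals n p (h j) \<Longrightarrow> finite (C j S)"
  shows "degree \<lparr>verts = V, edges = (SIGMA j:{1..m}. SIGMA S:transversals n p (h j). C j S),
      ends = (\<lambda>(i, S, c). mset_set S)\<rparr> v =
    (\<Sum>j=1..m. \<Sum>S\<in>transversals n p (h j). if v \<in> S then card (C j S) else 0)"
proof -
  have fin: "finite S" if "S \<in> transversals n p s" for S s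
    using that by (auto simp: transversals_def intro: finite_subset)
  have "(\<Sum>c\<in>C j S. count (mset_set S) v) = (if v \<in> S then card (C j S) else 0)"
    if "S \<in> transversals n p (h j)" for j S
    using fin[OF that] by (simp add: count_mset_set')
  then have "(\<Sum>j=1..m. \<Sum>S\<in>transversals n p (h j). if v \<in> S then card (C j S) else 0) =
      (\<Sum>j=1..m. \<Sum>S\<in>transversals n p (h j). \<Sum>c\<in>C j S. count (mset_set S) v)"
    by (intro sum.cong refl) simp
  also have "\<dots> = (\<Sum>j=1..m. \<Sum>y\<in>(SIGMA S:transversals n p (h j). C j S). count (mset_set (fst y)) v)"
    using assms
    by (intro sum.cong refl, subst sum.Sigma) (auto simp: finite_transversals case_prod_unfold)
  also have "\<dots> = (\<Sum>e\<in>(SIGMA j:{1..m}. SIGMA S:transversals n p (h j). C j S).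
      count (mset_set (fst (snd e))) v)"
    using assms by (subst sum.Sigma) (auto simp: finite_transversals case_prod_unfold)
  finally show ?thesis by (simp add: degree_def case_prod_unfold)
qed

section \<open>Counting for necessity\<close>

lemma degree_LamK:
  assumes "v \<in> {1..n} \<times> {1..p}" "\<forall>i\<in>{1..m}. h i \<in> {2..n}"
  shows "degree (LamK n p m lam h) v =
    (\<Sum>i=1..m. lam i * ((n - 1) choose (h i - 1)) * p ^ (h i - 1))"
proof -
  have "degree (LamK n p m lam h) v =
      (\<Sum>j=1..m. \<Sum>S\<in>transversals n p (h j). if v \<in> S then card {1..lam j} else 0)"
    unfolding LamK_def by (rule degree_transversal_hypergraph) simp
  also have "\<dots> = (\<Sum>i=1..m. lam i * ((n - 1) choose (h i - 1)) * p ^ (h i - 1))"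
  proof (intro sum.cong refl)
    fix j assume "j \<in> {1..m}"
    then have "1 \<le> h j" using assms(2) by force
    from card_transversals_containing[OF assms(1) this]
    show "(\<Sum>S\<in>transversals n p (h j). if v \<in> S then card {1..lam j} else 0) =
        lam j * ((n - 1) choose (h j - 1)) * p ^ (h j - 1)"
      by (simp add: finite_transversals flip: sum.inter_filter)
  qed
  finally show ?thesis .
qed

text \<open>Handshake identity: both sides count all hinges.\<close>

lemma sum_degree:
  assumes "wf_hypergraph G"
  shows "(\<Sum>v\<in>verts G. degree G v) = (\<Sum>e\<in>edges G. size (ends G e))"
proof -
  have "(\<Sum>v\<in>verts G. count (ends G e) v) = size (ends G e)" if "e \<in> edges G" for e
    unfolding size_multiset_overloaded_eq using assms that
    by (intro sum.mono_neutral_right) (auto simp: wf_hypergraph_def count_eq_zero_iff)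
  then show ?thesis
    unfolding degree_def by (subst sum.swap) (rule sum.cong, auto)
qed

lemma almost_factorization_degree:
  assumes F: "almost_factorization k r F G" and G: "wf_hypergraph G"
  shows "(\<Sum>i=1..k. degree (F i) v) = degree G v"
proof -
  have sub: "edges (F i) \<subseteq> edges G" "\<And>e. e \<in> edges (F i) \<Longrightarrow> ends (F i) e = ends G e"
    if "i \<in> {1..k}" for i
    using F that by (auto simp: almost_factorization_def is_factor_def spanning_subhypergraph_def)
  have "finite (edges (F i))" if "i \<in> {1..k}" for i
    using sub(1)[OF that] G by (auto simp: wf_hypergraph_def intro: finite_subset)
  then have "(\<Sum>e\<in>(\<Union>i\<in>{1..k}. edges (F i)). count (ends G e) v) =
      (\<Sum>i=1..k. \<Sum>e\<in>edges (F i). count (ends G e) v)"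
    using F by (intro sum.UNION_disjoint) (auto simp: almost_factorization_def disjoint_family_on_def)
  also have "\<dots> = (\<Sum>i=1..k. degree (F i) v)"
    unfolding degree_def using sub(2) by (intro sum.cong) auto
  finally show ?thesis using F by (simp add: degree_def almost_factorization_def)
qed

text \<open>The first component of an edge is the index of its size, so these cardinalities serve as
  the matrix entries. Over all classes, the edges of index \<open>j\<close> form a product
  set.\<close>

lemma sum_card_edges_of_index:
  fixes lam :: "nat \<Rightarrow> nat"
  assumes "almost_factorization k r F (LamK n p m lam h)" "wf_hypergraph (LamK n p m lam h)"
    and j: "j \<in> {1..m}"
  shows "(\<Sum>i=1..k. card {e \<in> edges (F i). fst e = j}) = lam j * (n choose h j) * p ^ h j"
proof -
  let ?G = "LamK n p m lam h"
  have sub: "edges (F i) \<subseteq> edges ?G" if "i \<in> {1..k}" for i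
    using assms(1) that by (auto simp: almost_factorization_def is_factor_def spanning_subhypergraph_def)
  have "finite (edges (F i))" if "i \<in> {1..k}" for i
    using sub[OF that] assms(2) by (auto simp: wf_hypergraph_def intro: finite_subset)
  moreover have "edges (F i) \<inter> edges (F i') = {}" if "i \<in> {1..k}" "i' \<in> {1..k}" "i \<noteq> i'" for i i'
    using assms(1) that unfolding almost_factorization_def disjoint_family_on_def by blast
  ultimately have "(\<Sum>i=1..k. card {e \<in> edges (F i). fst e = j}) = card (\<Union>i\<in>{1..k}. {e \<in> edges (F i). fst e = j})"
    by (intro card_UN_disjoint[symmetric] ballI impI) (simp, simp, blast)
  also have "(\<Union>i\<in>{1..k}. {e \<in> edges (F i). fst e = j}) = {e \<in> edges ?G. fst e = j}"
    using assms(1) by (auto simp: almost_factorization_def)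
  also have "\<dots> = {j} \<times> transversals n p (h j) \<times> {1..lam j}"
    using j by (auto simp: LamK_def)
  finally show ?thesis by (simp add: card_transversals card_cartesian_product)
qed

text \<open>An edge of index \<open>j\<close> has \<open>h j\<close> hinges, so the weighted sum
  counts the hinges of \<open>F\<close>, which is the degree sum over \<open>n * p\<close>
  vertices.\<close>

lemma is_factor_size_bounds:
  fixes lam :: "nat \<Rightarrow> nat"
  assumes F: "is_factor q r F (LamK n p m lam h)"
  shows "int (n * p) * q \<le> int (\<Sum>j=1..m. card {e \<in> edges F. fst e = j} * h j)"
    and "int (\<Sum>j=1..m. card {e \<in> edges F. fst e = j} * h j) \<le> int (n * p) * r"
proof -
  let ?G = "LamK n p m lam h"
  have F': "wf_hypergraph F" "verts F = verts ?G" "edges F \<subseteq> edges ?G"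
    "\<And>e. e \<in> edges F \<Longrightarrow> ends F e = ends ?G e"
    using F by (auto simp: is_factor_def spanning_subhypergraph_def)
  have fin: "finite (edges F)" using F'(1) by (simp add: wf_hypergraph_def)
  have V: "verts F = {1..n} \<times> {1..p}" using F'(2) by (simp add: LamK_def)
  have size: "size (ends F e) = h (fst e)" if "e \<in> edges F" for e
    using that F'(3,4) by (fastforce simp: LamK_def transversals_def)
  have "(\<Sum>v\<in>verts F. degree F v) = (\<Sum>e\<in>edges F. h (fst e))"
    unfolding sum_degree[OF F'(1)] using size by simp
  also have "\<dots> = (\<Sum>j=1..m. \<Sum>e\<in>{e \<in> edges F. fst e = j}. h (fst e))"
    using fin F'(3) by (intro sum.group[symmetric]) (auto simp: LamK_def)
  also have "\<dots> = (\<Sum>j=1..m. card {e \<in> edges F. fst e = j} * h j)"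
    by (intro sum.cong) auto
  finally have eq: "int (\<Sum>j=1..m. card {e \<in> edges F. fst e = j} * h j) = (\<Sum>v\<in>verts F. int (degree F v))"
    by (simp only: of_nat_sum[symmetric])
  have card: "int (card (verts F)) = int (n * p)" by (simp add: V card_cartesian_product)
  show "int (n * p) * q \<le> int (\<Sum>j=1..m. card {e \<in> edges F. fst e = j} * h j)"
    unfolding eq card[symmetric] using F by (intro sum_bounded_below) (auto simp: is_factor_def)
  show "int (\<Sum>j=1..m. card {e \<in> edges F. fst e = j} * h j) \<le> int (n * p) * r"
    unfolding eq card[symmetric] using F by (intro sum_bounded_above) (auto simp: is_factor_def)
qed

section \<open>Sufficiency: realizing the colour counts by factors\<close>

lemma almost_factorizable_LamKI:
  fixes lam h :: "nat \<Rightarrow> nat"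
  assumes h: "\<forall>i\<in>{1..m}. h i \<in> {2..n}"
    and rows: "\<And>i. i \<in> {1..k} \<Longrightarrow>
      int (n * p) * (int (r i) - 1) \<le> int (\<Sum>j=1..m. A i j * h j) \<and>
      (\<Sum>j=1..m. A i j * h j) \<le> n * p * r i"
    and cols: "\<And>j. j \<in> {1..m} \<Longrightarrow> (\<Sum>i=1..k. A i j) = lam j * (n choose h j) * p ^ h j"
  shows "almost_factorizable k r (LamK n p m lam h)"
proof -
  let ?G = "LamK n p m lam h" and ?T = "partial_transversals {1..n} p"
  have rows': "int n * (int p * (int (r i) - 1)) \<le> int (\<Sum>j=1..m. A i j * h j) \<and>
      int (\<Sum>j=1..m. A i j * h j) \<le> int n * (int p * int (r i))" if "i \<in> {1..k}" for i
  proof -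
    have "int (n * p * r i) = int n * (int p * int (r i))" by simp
    then show ?thesis using rows[OF that] by (simp only: of_nat_mult mult.assoc flip: of_nat_le_iff[where 'a = int])
  qed
  have cols': "(\<Sum>i=1..k. A i j) = lam j * ((n choose h j) * p ^ h j)" if "j \<in> {1..m}" for j
    using cols[OF that] by (simp only: mult.assoc)
  \<comment> \<open>All \<open>n\<close> parts are detached. What remains is to pass from the counts
    \<open>X i j S\<close> to actual classes of edges.\<close>
  obtain X where
    X1: "\<forall>j\<in>{1..m}. \<forall>S\<in>?T. (\<Sum>i=1..k. X i j S) = lam j * completions p (n - n) (h j) (card S)" and
    X2: "\<forall>i\<in>{1..k}. \<forall>v\<in>{1..n} \<times> {1..p}.
      int (r i) - 1 \<le> int (\<Sum>j=1..m. \<Sum>S\<in>?T. if v \<in> S then X i j S else 0) \<and>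
      int (\<Sum>j=1..m. \<Sum>S\<in>?T. if v \<in> S then X i j S else 0) \<le> int (r i)"
    using partial_transversals_coloring[of "{1..k}" "{1..m}" n n A lam h p "\<lambda>i. int (r i) - 1" "\<lambda>i. int (r i)",
        OF finite_atLeastAtMost finite_atLeastAtMost order_refl cols' rows']
    by blast
  have comp0: "completions p 0 s t = of_bool (s = t)" for s t
    by (auto simp: completions_def)
  \<comment> \<open>With no part left, only sets of the full size \<open>h j\<close> carry edges, so
    sums over \<open>?T\<close> reduce to sums over \<open>transversals n p (h j)\<close>.\<close>
  have X0: "X i j S = 0" if "i \<in> {1..k}" "j \<in> {1..m}" "S \<in> ?T" "card S \<noteq> h j" for i j S
    using bspec[OF bspec[OF X1 that(2)] that(3)] that by (simp add: comp0)
  define Q where "Q j S g \<longleftrightarrow> (\<forall>c\<in>{1..lam j}. g c \<in> {1..k}) \<and>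
    (\<forall>i\<in>{1..k}. card {c \<in> {1..lam j}. g c = i} = X i j S)" for j S g
  \<comment> \<open>Degrees depend only on the number of copies of each colour, so the copies on
    each \<open>S\<close> can be coloured independently.\<close>
  define g where "g j S = (SOME g. Q j S g)" for j S
  have "Q j S (g j S)" if "j \<in> {1..m}" "S \<in> transversals n p (h j)" for j S
    unfolding g_def
  proof (rule someI_ex[of "Q _ _"])
    have "S \<in> ?T" "card S = h j" using that(2) by (auto simp: transversals_eq)
    with X1 that(1) have "(\<Sum>i=1..k. X i j S) = lam j" by (simp add: comp0)
    then show "\<exists>g. Q j S g" unfolding Q_def by (rule coloring_with_class_sizes)
  qed
  then have g: "\<And>j S c. j \<in> {1..m} \<Longrightarrow> S \<in> transversals n p (h j) \<Longrightarrow> c \<in> {1..lam j} \<Longrightarrow> g j S c \<in> {1..k}"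
    "\<And>j S i. j \<in> {1..m} \<Longrightarrow> S \<in> transversals n p (h j) \<Longrightarrow> i \<in> {1..k} \<Longrightarrow>
      card {c \<in> {1..lam j}. g j S c = i} = X i j S"
    unfolding Q_def by blast+
  define F where "F i = \<lparr>verts = {1..n} \<times> {1..p},
    edges = (SIGMA j:{1..m}. SIGMA S:transversals n p (h j). {c \<in> {1..lam j}. g j S c = i}),
    ends = (\<lambda>(i :: nat, S :: (nat \<times> nat) set, c :: nat). mset_set S)\<rparr>" for i
  have deg: "degree (F i) v = (\<Sum>j=1..m. \<Sum>S\<in>?T. if v \<in> S then X i j S else 0)"
    if i: "i \<in> {1..k}" for i v
  proof -
    have "degree (F i) v = (\<Sum>j=1..m. \<Sum>S\<in>transversals n p (h j).
        if v \<in> S then card {c \<in> {1..lam j}. g j S c = i} else 0)"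
      unfolding F_def by (rule degree_transversal_hypergraph) simp
    also have "\<dots> = (\<Sum>j=1..m. \<Sum>S\<in>?T. if v \<in> S then X i j S else 0)"
    proof (rule sum.cong[OF refl])
      fix j assume j: "j \<in> {1..m}"
      show "(\<Sum>S\<in>transversals n p (h j). if v \<in> S then card {c \<in> {1..lam j}. g j S c = i} else 0) =
          (\<Sum>S\<in>?T. if v \<in> S then X i j S else 0)"
        using g(2)[OF j _ i] X0[OF i j]
        by (intro sum.mono_neutral_cong_left) (auto simp: transversals_eq finite_partial_transversals)
    qed
    finally show ?thesis .
  qed
  have sub: "edges (F i) \<subseteq> edges ?G" "verts (F i) = verts ?G" "ends (F i) = ends ?G" for i
    by (auto simp: F_def LamK_def)
  have wf: "wf_hypergraph ?G" using h by (rule wf_LamK)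
  have wfF: "wf_hypergraph (F i)" for i
    using wf sub(1)[of i] unfolding wf_hypergraph_def sub(2,3) by (auto intro: finite_subset)
  have "is_factor (int (r i) - 1) (int (r i)) (F i) ?G" if i: "i \<in> {1..k}" for i
  proof -
    have "int (r i) - 1 \<le> int (degree (F i) v) \<and> int (degree (F i) v) \<le> int (r i)"
      if "v \<in> verts (F i)" for v
      using X2 i that unfolding deg[OF i] by (simp only: F_def hypergraph.simps)
    then show ?thesis
      using wf wfF sub unfolding is_factor_def spanning_subhypergraph_def by simp
  qed
  moreover have "(\<Union>i\<in>{1..k}. edges (F i)) = edges ?G"
    using g(1) sub(1) by (fastforce simp: F_def LamK_def)
  moreover have "disjoint_family_on (\<lambda>i. edges (F i)) {1..k}"
    by (auto simp: disjoint_family_on_def F_def)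
  ultimately show ?thesis
    unfolding almost_factorizable_def almost_factorization_def by (intro exI[of _ F]) blast
qed

theorem theorem6p6:
  fixes n p k m :: nat and r lam h :: "nat \<Rightarrow> nat"
  assumes "n \<ge> 1" and "p \<ge> 1"
    and "\<forall>i\<in>{1..m}. h i \<in> {2..n}"
    and "inj_on h {1..m}"
  shows "almost_factorizable k r (LamK n p m lam h) \<longleftrightarrow>
    (\<Sum>i=1..k. int (r i)) - int k
        \<le> int (\<Sum>i=1..m. lam i * ((n - 1) choose (h i - 1)) * p ^ (h i - 1)) \<and>
    (\<Sum>i=1..m. lam i * ((n - 1) choose (h i - 1)) * p ^ (h i - 1)) \<le> (\<Sum>i=1..k. r i) \<and>
    (\<exists>A :: nat \<Rightarrow> nat \<Rightarrow> nat.
       (\<forall>i\<in>{1..k}.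
          int (n * p) * (int (r i) - 1) \<le> int (\<Sum>j=1..m. A i j * h j) \<and>
          (\<Sum>j=1..m. A i j * h j) \<le> n * p * r i) \<and>
       (\<forall>j\<in>{1..m}. (\<Sum>i=1..k. A i j) = lam j * (n choose h j) * p ^ h j))"
    (is "?fact \<longleftrightarrow> ?lo \<and> ?hi \<and> ?A")
proof
  let ?G = "LamK n p m lam h"
  assume ?fact
  then obtain F where F: "almost_factorization k r F ?G" by (auto simp: almost_factorizable_def)
  have wf: "wf_hypergraph ?G" using assms(3) by (rule wf_LamK)
  have factor: "is_factor (int (r i) - 1) (int (r i)) (F i) ?G" if "i \<in> {1..k}" for i
    using F that by (simp add: almost_factorization_def)
  \<comment> \<open>All vertices of \<open>LamK\<close> have the same degree, so the degree bounds
    of the classes at a single vertex give both inequalities.\<close>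
  have v: "(1, 1) \<in> {1..n} \<times> {1..p}" using assms by simp
  let ?d = "\<lambda>i. degree (F i) (1, 1)"
  have d: "int (r i) - 1 \<le> int (?d i)" "int (?d i) \<le> int (r i)" if "i \<in> {1..k}" for i
    using factor[OF that] v by (auto simp: is_factor_def spanning_subhypergraph_def LamK_def)
  have deg: "(\<Sum>i=1..m. lam i * ((n - 1) choose (h i - 1)) * p ^ (h i - 1)) = (\<Sum>i=1..k. ?d i)"
    using almost_factorization_degree[OF F wf] degree_LamK[OF v assms(3)] by simp
  have "(\<Sum>i=1..k. int (r i)) - int k = (\<Sum>i=1..k. int (r i) - 1)"
    by (simp add: sum_subtractf)
  also have "\<dots> \<le> (\<Sum>i=1..k. int (?d i))" using d by (intro sum_mono) auto
  finally have ?lo unfolding deg by simp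
  moreover have ?hi unfolding deg using d by (intro sum_mono) simp
  \<comment> \<open>The matrix entry is the number of edges of size \<open>h j\<close> in the class
    \<open>F i\<close>.\<close>
  moreover have ?A
  proof (intro exI[of _ "\<lambda>i j. card {e \<in> edges (F i). fst e = j}"] conjI ballI)
    fix i assume i: "i \<in> {1..k}"
    show "int (n * p) * (int (r i) - 1) \<le> int (\<Sum>j=1..m. card {e \<in> edges (F i). fst e = j} * h j)"
      using factor[OF i] by (rule is_factor_size_bounds)
    have "int (\<Sum>j=1..m. card {e \<in> edges (F i). fst e = j} * h j) \<le> int (n * p) * int (r i)"
      using factor[OF i] by (rule is_factor_size_bounds)
    then show "(\<Sum>j=1..m. card {e \<in> edges (F i). fst e = j} * h j) \<le> n * p * r i"
      by (simp only: of_nat_le_iff flip: of_nat_mult)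
  qed (rule sum_card_edges_of_index[OF F wf])
  ultimately show "?lo \<and> ?hi \<and> ?A" by blast
next
  assume "?lo \<and> ?hi \<and> ?A"
  then show ?fact using almost_factorizable_LamKI[OF assms(3)] by blast
qed

end
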